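(* Let $\gamma: I\to\mathbb{R}^3$ be a smooth non-degenerate curve, let $1<p<\infty$ and let $\alpha\in\mathbb{R}$. (1) Let $t>0$. If there is a constant $C$, independent of $f$, such that $$\int_{\mathbb{R}^3}|A_tf(x)|^p\,|x|^{\alpha}\,dx\le C\int_{\mathbb{R}^3}|f(x)|^p\,|x|^{\alpha}\,dx$$ holds for all $f$, then $-1\le\alpha\le p-1$. (2) If the maximal operator $M$ maps $L^p(|x|^{\alpha})$ to itself boundedly, then $-1\le\alpha\le p-3$. The same conclusion holds if $M$ is replaced by the local maximal operator $M_{\mathrm{loc}}$.
   Context: Let $I\subset\mathbb{R}$ be an interval. A smooth curve $\gamma:I\to\mathbb{R}^3$ is called non-degenerate if there is a constant $c_0>0$ such that $|\det(\gamma'(s),\gamma''(s),\gamma'''(s))|\ge c_0$ for all $s\in I$. Let $\chi$ be a bump function (smooth, nonnegative, not identically zero) supported in the interior of $I$. For $t>0$ put $$A_tf(x)=\int_I f(x-t\gamma(s))\,\chi(s)\,ds,\qquad Mf(x)=\sup_{t>0}|A_tf(x)|,\qquad M_{\mathrm{loc}}f(x)=\sup_{1\le t\le2}|A_tf(x)|.$$ The space $L^p(|x|^{\alpha})$ on $\mathbb{R}^3$ has norm $\|f\|_{L^p(|x|^\alpha)}=\big(\int_{\mathbb{R}^3}|f(x)|^p|x|^{\alpha}dx\big)^{1/p}$. An operator $T$ maps $L^p(|x|^\alpha)$ to itself boundedly if there is a constant $C$ with $\|Tf\|_{L^p(|x|^\alpha)}\le C\|f\|_{L^p(|x|^\alpha)}$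 for all $f\in L^p(|x|^\alpha)$. *)

theory Defs
  imports "HOL-Analysis.Analysis"
begin

text \<open>Derivatives are taken within the interval, hence one-sided at an endpoint belonging to it.\<close>

primrec iter_deriv :: "real set \<Rightarrow> nat \<Rightarrow> (real \<Rightarrow> 'a::real_normed_vector) \<Rightarrow> real \<Rightarrow> 'a" where
  "iter_deriv I 0 f = f"
| "iter_deriv I (Suc n) f = (\<lambda>s. vector_derivative (iter_deriv I n f) (at s within I))"

definition smooth_within :: "real set \<Rightarrow> (real \<Rightarrow> 'a::real_normed_vector) \<Rightarrow> bool" where
  "smooth_within I f \<longleftrightarrow> (\<forall>n. iter_deriv I n f differentiable_on I)"

definition nondegenerate :: "real set \<Rightarrow> (real \<Rightarrow> real^3) \<Rightarrow> bool" where
  "nondegenerate I \<gamma> \<longleftrightarrow>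
     (\<exists>c0>0. \<forall>s\<in>I.
        \<bar>det (vector [iter_deriv I 1 \<gamma> s, iter_deriv I 2 \<gamma> s, iter_deriv I 3 \<gamma> s] :: real^3^3)\<bar> \<ge> c0)"

definition bump_function_in :: "real set \<Rightarrow> (real \<Rightarrow> real) \<Rightarrow> bool" where
  "bump_function_in I \<psi> \<longleftrightarrow>
     smooth_within UNIV \<psi> \<and> (\<forall>s. 0 \<le> \<psi> s) \<and> (\<exists>s. \<psi> s \<noteq> 0) \<and>
     compact (closure {s. \<psi> s \<noteq> 0}) \<and> closure {s. \<psi> s \<noteq> 0} \<subseteq> interior I"

definition avg_op ::
  "real set \<Rightarrow> (real \<Rightarrow> real^3) \<Rightarrow> (real \<Rightarrow> real) \<Rightarrow> real \<Rightarrow> (real^3 \<Rightarrow> real) \<Rightarrow> real^3 \<Rightarrow> real" where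
  "avg_op I \<gamma> \<psi> t f x = (LINT s:I|lebesgue. f (x - t *\<^sub>R \<gamma> s) * \<psi> s)"

text \<open>The suprema may be infinite, so the maximal functions take values in \<^typ>\<open>ennreal\<close>.\<close>

definition max_op ::
  "real set \<Rightarrow> (real \<Rightarrow> real^3) \<Rightarrow> (real \<Rightarrow> real) \<Rightarrow> (real^3 \<Rightarrow> real) \<Rightarrow> real^3 \<Rightarrow> ennreal" where
  "max_op I \<gamma> \<psi> f x = (SUP t\<in>{0<..}. ennreal \<bar>avg_op I \<gamma> \<psi> t f x\<bar>)"

definition max_op_loc ::
  "real set \<Rightarrow> (real \<Rightarrow> real^3) \<Rightarrow> (real \<Rightarrow> real) \<Rightarrow> (real^3 \<Rightarrow> real) \<Rightarrow> real^3 \<Rightarrow> ennreal" where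
  "max_op_loc I \<gamma> \<psi> f x = (SUP t\<in>{1..2}. ennreal \<bar>avg_op I \<gamma> \<psi> t f x\<bar>)"

text \<open>Powers of extended nonnegative reals, used for exponents \<open>a > 0\<close> only.\<close>

definition ennreal_powr :: "ennreal \<Rightarrow> real \<Rightarrow> ennreal" where
  "ennreal_powr y a = (if y = top then top else ennreal (enn2real y powr a))"

definition weighted_integral :: "real \<Rightarrow> real \<Rightarrow> (real^3 \<Rightarrow> ennreal) \<Rightarrow> ennreal" where
  "weighted_integral p \<alpha> g = (\<integral>\<^sup>+x. ennreal_powr (g x) p * ennreal (norm x powr \<alpha>) \<partial>lebesgue)"

definition weighted_norm :: "real \<Rightarrow> real \<Rightarrow> (real^3 \<Rightarrow> ennreal) \<Rightarrow> ennreal" where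
  "weighted_norm p \<alpha> g = ennreal_powr (weighted_integral p \<alpha> g) (1 / p)"

definition weighted_Lp :: "real \<Rightarrow> real \<Rightarrow> (real^3 \<Rightarrow> real) set" where
  "weighted_Lp p \<alpha> =
     {f \<in> borel_measurable lebesgue. weighted_norm p \<alpha> (\<lambda>x. ennreal \<bar>f x\<bar>) < top}"

definition bounded_on_weighted_Lp ::
  "real \<Rightarrow> real \<Rightarrow> ((real^3 \<Rightarrow> real) \<Rightarrow> real^3 \<Rightarrow> ennreal) \<Rightarrow> bool" where
  "bounded_on_weighted_Lp p \<alpha> T \<longleftrightarrow>
     (\<exists>C::real. \<forall>f\<in>weighted_Lp p \<alpha>.
        weighted_norm p \<alpha> (T f) \<le> ennreal C * weighted_norm p \<alpha> (\<lambda>x. ennreal \<bar>f x\<bar>))"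

end

theory Submission
  imports Defs "HOL-Analysis.Cross3" "HOL-Real_Asymp.Real_Asymp"
begin

text \<open>
  All bounds come from testing the operators on indicator functions \<open>1\<^sub>U\<close> at a scale \<open>\<delta> = 1/n \<rightarrow> 0\<close>.
  If \<open>U\<close> is the \<open>\<delta>\<close>-neighbourhood of an arc of \<open>- t \<gamma>\<close> away from the origin, then \<open>A\<^sub>t 1\<^sub>U \<ge> const\<close> on a
  \<open>\<delta>\<close>-ball near the origin, so \<open>\<delta>\<^bsup>3+\<alpha>\<^esup>\<close> is bounded by a multiple of \<open>\<delta>\<^bsup>2\<^esup>\<close> and \<open>\<alpha> \<ge> -1\<close>. Dually, if \<open>U\<close> is
  a \<open>\<delta>\<close>-ball about the origin, then \<open>A\<^sub>t 1\<^sub>U \<ge> const \<delta>\<close> on the \<open>\<delta>\<close>-neighbourhood of an arc of \<open>t \<gamma>\<close>,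
  so \<open>\<delta>\<^bsup>p+2\<^esup>\<close> is bounded by a multiple of \<open>\<delta>\<^bsup>3+\<alpha>\<^esup>\<close> and \<open>\<alpha> \<le> p - 1\<close>.

  For the maximal operators, choose \<open>a\<close> with \<open>\<gamma>'(a)\<close>, \<open>\<gamma>''(a)\<close>, \<open>\<gamma>(a)\<close> linearly independent, and let \<open>U\<close> be
  a box about \<open>k \<gamma>(a)\<close> with sides proportional to \<open>\<delta>\<close>, \<open>\<delta>\<^bsup>2\<^esup>\<close>, \<open>\<delta>\<^bsup>3\<^esup>\<close> along these vectors. By Taylor's
  formula the maximal function is at least \<open>const \<delta>\<close> on the box with sides \<open>\<delta>\<close>, \<open>\<delta>\<^bsup>2\<^esup>\<close>, \<open>1\<close>
  swept out by the dilations. For \<open>\<alpha> \<ge> 0\<close> and \<open>k = 0\<close> this compares \<open>\<delta>\<^bsup>p+3\<^esup>\<close> with \<open>\<delta>\<^bsup>6+\<alpha>\<^esup>\<close>; for \<open>\<alpha> < 0\<close> the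
  box is moved away from the origin (\<open>k = 1\<close>), which gives \<open>p \<ge> 3\<close>.
\<close>

section \<open>Strong-type inequalities on indicator functions\<close>

text \<open>If a > b, multiplying by \<open>n powr a\<close> leaves
  \<open>c * n powr (a - b)\<close> on the left, which exceeds every constant. This turns each test
  at the scales 1/n into an inequality between exponents.\<close>

lemma exponent_le_if_eventually_le:
  fixes a b c C :: real
  assumes le: "\<forall>\<^sub>F n in sequentially. c * (1 / real n) powr b \<le> C * (1 / real n) powr a" and c: "c > 0"
  shows "a \<le> b"
proof (rule ccontr)
  assume "\<not> a \<le> b"
  then have "a - b > 0" by simp
  then have "filterlim (\<lambda>n. c * real n powr (a - b)) at_top sequentially"
    using c by real_asymp
  then have "\<forall>\<^sub>F n in sequentially. c * real n powr (a - b) > C"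
    by (simp add: filterlim_at_top_dense)
  with le eventually_gt_at_top[of 0] have "\<forall>\<^sub>F n::nat in sequentially. False"
  proof eventually_elim
    case (elim n)
    have *: "(1 / real n) powr x = real n powr - x" for x
      using elim by (simp add: powr_minus_divide powr_divide)
    have "c * real n powr (a - b) * real n powr - a = c * real n powr - b"
      by (simp add: mult.assoc flip: powr_add)
    also have "\<dots> \<le> C * real n powr - a"
      using elim unfolding * by simp
    finally have "c * real n powr (a - b) * real n powr - a \<le> C * real n powr - a" .
    moreover have "real n powr - a > 0" using elim by simp
    ultimately have "c * real n powr (a - b) \<le> C" by simp
    with elim show ?case by simp
  qed
  then show False by simp
qed

lemma ennreal_powr_ennreal: "ennreal_powr (ennreal x) a = ennreal (x powr a)" if "x \<ge> 0"
  using that by (simp add: ennreal_powr_def)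

lemma ennreal_powr_mono: "x \<le> y \<Longrightarrow> a \<ge> 0 \<Longrightarrow> ennreal_powr x a \<le> ennreal_powr y a"
  by (cases x; cases y)
     (auto simp: ennreal_powr_def top_unique intro!: ennreal_leI powr_mono2)

lemma weighted_integral_mono:
  "(\<And>x. g x \<le> h x) \<Longrightarrow> p \<ge> 0 \<Longrightarrow> weighted_integral p \<alpha> g \<le> weighted_integral p \<alpha> h"
  unfolding weighted_integral_def
  by (intro nn_integral_mono mult_right_mono ennreal_powr_mono) auto

text \<open>Comparison with a multiple of the indicator of \<open>E\<close> uses only monotonicity
  of the nonnegative integral, which is valid for arbitrary \<open>g\<close>, such as a supremum
  over uncountably many dilations.\<close>

lemma weighted_integral_ge:
  assumes "E \<in> lmeasurable" and "p > 0" "h \<ge> 0" "w \<ge> 0"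
    and h: "\<And>x. x \<in> E \<Longrightarrow> ennreal h \<le> g x"
    and w: "\<And>x. x \<in> E \<Longrightarrow> w \<le> norm x powr \<alpha>"
  shows "ennreal (h powr p * w * measure lebesgue E) \<le> weighted_integral p \<alpha> g"
proof -
  have "ennreal (h powr p * w * measure lebesgue E) = (\<integral>\<^sup>+x. ennreal (h powr p * w) * indicator E x \<partial>lebesgue)"
    using assms by (simp add: nn_integral_cmult_indicator emeasure_eq_measure2 ennreal_mult'' fmeasurableD)
  also have "\<dots> \<le> weighted_integral p \<alpha> g"
    unfolding weighted_integral_def
  proof (rule nn_integral_mono)
    fix x :: "real^3"
    show "ennreal (h powr p * w) * indicator E x \<le> ennreal_powr (g x) p * ennreal (norm x powr \<alpha>)"
    proof (cases "x \<in> E")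
      case True
      have "ennreal (h powr p * w) = ennreal_powr (ennreal h) p * ennreal w"
        using assms by (simp add: ennreal_powr_ennreal ennreal_mult)
      also have "\<dots> \<le> ennreal_powr (g x) p * ennreal (norm x powr \<alpha>)"
        using True assms by (intro mult_mono ennreal_powr_mono ennreal_leI) auto
      finally show ?thesis using True by simp
    qed simp
  qed
  finally show ?thesis .
qed

lemma weighted_integral_indicator_le:
  assumes "U \<in> lmeasurable" and "p > 0" "W \<ge> 0"
    and W: "\<And>x. x \<in> U \<Longrightarrow> norm x powr \<alpha> \<le> W"
  shows "weighted_integral p \<alpha> (\<lambda>x. ennreal \<bar>indicat_real U x\<bar>) \<le> ennreal (W * measure lebesgue U)"
proof -
  have "weighted_integral p \<alpha> (\<lambda>x. ennreal \<bar>indicat_real U x\<bar>) \<le> (\<integral>\<^sup>+x. ennreal W * indicator U x \<partial>lebesgue)"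
    unfolding weighted_integral_def
    by (intro nn_integral_mono)
       (use W in \<open>auto simp: ennreal_powr_ennreal indicator_def ennreal_powr_def intro!: ennreal_leI\<close>)
  also have "\<dots> = ennreal (W * measure lebesgue U)"
    using assms by (simp add: nn_integral_cmult_indicator emeasure_eq_measure2 ennreal_mult fmeasurableD)
  finally show ?thesis .
qed

lemma indicator_in_weighted_Lp:
  assumes "U \<in> lmeasurable" and "p > 0" "W \<ge> 0"
    and W: "\<And>x. x \<in> U \<Longrightarrow> norm x powr \<alpha> \<le> W"
  shows "indicat_real U \<in> weighted_Lp p \<alpha>"
proof -
  have "weighted_norm p \<alpha> (\<lambda>x. ennreal \<bar>indicat_real U x\<bar>) \<le> ennreal_powr (ennreal (W * measure lebesgue U)) (1/p)"
    unfolding weighted_norm_def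
    using weighted_integral_indicator_le[OF assms] \<open>p > 0\<close> by (intro ennreal_powr_mono) auto
  also have "\<dots> < top"
    using assms by (simp add: ennreal_powr_ennreal)
  finally show ?thesis
    using assms by (auto simp: weighted_Lp_def fmeasurableD)
qed

text \<open>Boundedness in terms of p-th powers instead of norms, so that single averages and
  maximal operators can be tested by the same lemma.\<close>

definition strong_type :: "real \<Rightarrow> real \<Rightarrow> real \<Rightarrow> ((real^3 \<Rightarrow> real) \<Rightarrow> real^3 \<Rightarrow> ennreal) \<Rightarrow> bool" where
  "strong_type p \<alpha> C T \<longleftrightarrow>
     (\<forall>f\<in>weighted_Lp p \<alpha>. weighted_integral p \<alpha> (T f) \<le> ennreal C * weighted_integral p \<alpha> (\<lambda>x. ennreal \<bar>f x\<bar>))"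

text \<open>Constant bounds for the weight, above on \<open>U\<close> and below on \<open>E\<close>,
  reduce the inequality to a comparison of two volumes. The maximum with 0 appears since
  \<open>ennreal C\<close> is 0 for negative \<open>C\<close>.\<close>

lemma strong_type_indicator:
  assumes T: "strong_type p \<alpha> C T"
    and p: "p > 0" and U: "U \<in> lmeasurable" and E: "E \<in> lmeasurable"
    and W: "W \<ge> 0" "\<And>x. x \<in> U \<Longrightarrow> norm x powr \<alpha> \<le> W"
    and w: "w \<ge> 0" "\<And>x. x \<in> E \<Longrightarrow> w \<le> norm x powr \<alpha>"
    and h: "h \<ge> 0" "\<And>x. x \<in> E \<Longrightarrow> ennreal h \<le> T (indicat_real U) x"
  shows "h powr p * w * measure lebesgue E \<le> max C 0 * W * measure lebesgue U"
proof -
  have "ennreal (h powr p * w * measure lebesgue E) \<le> weighted_integral p \<alpha> (T (indicat_real U))"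
    using E p h w by (intro weighted_integral_ge) auto
  also have "\<dots> \<le> ennreal C * weighted_integral p \<alpha> (\<lambda>x. ennreal \<bar>indicat_real U x\<bar>)"
    using T indicator_in_weighted_Lp[OF U p W] by (auto simp: strong_type_def)
  also have "\<dots> \<le> ennreal (max C 0) * ennreal (W * measure lebesgue U)"
    using weighted_integral_indicator_le[OF U p W] by (intro mult_mono ennreal_leI) auto
  also have "\<dots> = ennreal (max C 0 * W * measure lebesgue U)"
    using W by (subst ennreal_mult[symmetric]) (auto simp: mult.assoc)
  finally show ?thesis
    using W by (simp add: ennreal_le_iff)
qed

lemma strong_type_mono:
  assumes "strong_type p \<alpha> C T" "p \<ge> 0" "\<And>f x. S f x \<le> T f x"
  shows "strong_type p \<alpha> C S"
  using assms unfolding strong_type_def by (meson order_trans weighted_integral_mono)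

lemma strong_type_if_bounded:
  assumes "bounded_on_weighted_Lp p \<alpha> T" and p: "p > 0"
  obtains C where "strong_type p \<alpha> C T"
proof -
  obtain C :: real where C: "\<And>f. f \<in> weighted_Lp p \<alpha> \<Longrightarrow>
      weighted_norm p \<alpha> (T f) \<le> ennreal C * weighted_norm p \<alpha> (\<lambda>x. ennreal \<bar>f x\<bar>)"
    using assms by (auto simp: bounded_on_weighted_Lp_def)
  define D where "D = max C 0"
  have "weighted_integral p \<alpha> (T f) \<le> ennreal (D powr p) * weighted_integral p \<alpha> (\<lambda>x. ennreal \<bar>f x\<bar>)"
    if f: "f \<in> weighted_Lp p \<alpha>" for f
  proof -
    let ?X = "weighted_integral p \<alpha> (T f)" and ?Y = "weighted_integral p \<alpha> (\<lambda>x. ennreal \<bar>f x\<bar>)"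
    have "?Y \<noteq> top"
      using f by (auto simp: weighted_Lp_def weighted_norm_def ennreal_powr_def)
    then obtain y where y: "y \<ge> 0" "?Y = ennreal y" by (cases ?Y) auto
    have "ennreal_powr ?X (1/p) \<le> ennreal C * ennreal_powr ?Y (1/p)"
      using C[OF f] by (simp add: weighted_norm_def)
    also have "\<dots> = ennreal (D * y powr (1/p))"
      using y by (simp add: ennreal_powr_ennreal D_def ennreal_mult max_def ennreal_neg)
    finally have le: "ennreal_powr ?X (1/p) \<le> ennreal (D * y powr (1/p))" .
    \<comment> \<open>\<open>ennreal_powr\<close> keeps top at top, so the finite bound excludes an
      infinite integral, and real p-th powers can be taken.\<close>
    then have "?X \<noteq> top" by (auto simp: ennreal_powr_def top_unique)
    then obtain x where x: "x \<ge> 0" "?X = ennreal x" by (cases ?X) auto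
    have "x powr (1/p) \<le> D * y powr (1/p)"
      using le x by (simp add: ennreal_powr_ennreal D_def)
    then have "(x powr (1/p)) powr p \<le> (D * y powr (1/p)) powr p"
      using p by (intro powr_mono2) auto
    then have "x \<le> D powr p * y"
      using p x y by (simp add: powr_powr powr_mult D_def)
    then show ?thesis
      using x y by (simp flip: ennreal_mult add: ennreal_leI)
  qed
  then show ?thesis
    by (intro that[of "D powr p"]) (simp add: strong_type_def)
qed

lemma max_op_loc_le_max_op: "max_op_loc I \<gamma> \<psi> f x \<le> max_op I \<gamma> \<psi> f x"
  unfolding max_op_def max_op_loc_def by (intro SUP_subset_mono) auto

lemma avg_op_le_max_op_loc:
  "1 \<le> t \<Longrightarrow> t \<le> 2 \<Longrightarrow> ennreal \<bar>avg_op I \<gamma> \<psi> t f x\<bar> \<le> max_op_loc I \<gamma> \<psi> f x"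
  unfolding max_op_loc_def by (intro SUP_upper) auto

section \<open>Averages along a non-degenerate curve\<close>

locale bump_curve =
  fixes I :: "real set" and \<gamma> :: "real \<Rightarrow> real^3" and \<psi> :: "real \<Rightarrow> real"
  assumes interval: "is_interval I"
    and smooth: "smooth_within I \<gamma>"
    and nondeg: "nondegenerate I \<gamma>"
    and bump: "bump_function_in I \<psi>"
begin

lemma continuous_on_iter_deriv: "continuous_on I (iter_deriv I n \<gamma>)"
  using smooth by (simp add: smooth_within_def differentiable_imp_continuous_on)

lemma has_vector_derivative_iter_deriv:
  assumes "s \<in> interior I"
  shows "(iter_deriv I n \<gamma> has_vector_derivative iter_deriv I (Suc n) \<gamma> s) (at s)"
proof -
  have "iter_deriv I n \<gamma> differentiable (at s)"
    using assms smooth interior_subset at_within_interior[OF assms]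
    by (fastforce simp: smooth_within_def differentiable_on_def)
  then show ?thesis
    by (simp add: vector_derivative_works at_within_interior[OF assms])
qed

lemma continuous_bump: "continuous_on UNIV \<psi>"
proof -
  have "iter_deriv UNIV 0 \<psi> differentiable_on UNIV"
    using bump unfolding bump_function_in_def smooth_within_def by blast
  then show ?thesis by (simp add: differentiable_imp_continuous_on)
qed

lemma integrable_bump: "integrable lebesgue \<psi>"
proof -
  let ?K = "closure {s. \<psi> s \<noteq> 0}"
  have "integrable lborel (\<lambda>x. indicat_real ?K x *\<^sub>R \<psi> x)"
    using bump continuous_on_subset[OF continuous_bump]
    by (intro borel_integrable_compact) (auto simp: bump_function_in_def)
  moreover have "(\<lambda>x. indicat_real ?K x *\<^sub>R \<psi> x) = \<psi>"
    using closure_subset[of "{s. \<psi> s \<noteq> 0}"] by (intro ext) (auto simp: indicator_def)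
  ultimately have "integrable lborel \<psi>" by simp
  then show ?thesis
    by (simp add: integrable_completion borel_measurable_integrable)
qed

text \<open>The integrand is nonnegative, so its part over [a,b], where it is at least
  \<open>m\<close>, bounds the average from below. Integrability must be checked, since the Bochner
  integral of a non-integrable function is 0.\<close>

lemma avg_op_indicator_ge:
  assumes U: "closed U" and ab: "a \<le> b" "{a..b} \<subseteq> I" and "m \<ge> 0"
    and m: "\<And>s. s \<in> {a..b} \<Longrightarrow> m \<le> \<psi> s"
    and inU: "\<And>s. s \<in> {a..b} \<Longrightarrow> x - t *\<^sub>R \<gamma> s \<in> U"
  shows "m * (b - a) \<le> avg_op I \<gamma> \<psi> t (indicat_real U) x"
proof -
  let ?g = "\<lambda>s. x - t *\<^sub>R \<gamma> s"
  have \<psi>: "\<psi> s \<ge> 0" for s using bump by (simp add: bump_function_in_def)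
  \<comment> \<open>The curve is controlled only on \<open>I\<close>, so the preimage of
    \<open>U\<close> is obtained as the trace on \<open>I\<close> of a closed set \<open>V\<close>;
    this makes it measurable.\<close>
  have "continuous_on I ?g"
    using continuous_on_iter_deriv[of 0] by (intro continuous_intros) simp
  then obtain V where V: "closed V" "I \<inter> ?g -` U = V \<inter> I"
    using U unfolding continuous_on_closed_invariant by (metis Int_commute)
  have "I \<in> sets lebesgue"
    using interval by (simp add: real_interval_borel_measurable)
  then have meas: "I \<inter> ?g -` U \<in> sets lebesgue" using V by auto
  have eq: "indicat_real I s *\<^sub>R (indicat_real U (?g s) * \<psi> s) = \<psi> s * indicat_real (I \<inter> ?g -` U) s" for s
    by (auto simp: indicator_def)
  have int: "integrable lebesgue (\<lambda>s. \<psi> s * indicat_real (I \<inter> ?g -` U) s)"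
    using meas integrable_bump by (rule integrable_real_mult_indicator)
  have int': "integrable lebesgue (\<lambda>s. m * indicat_real {a..b} s)"
    using ab by (intro integrable_mult_right integrable_real_indicator) auto
  have "m * (b - a) = (LINT s|lebesgue. m * indicat_real {a..b} s)"
    using ab by simp
  also have "\<dots> \<le> (LINT s|lebesgue. \<psi> s * indicat_real (I \<inter> ?g -` U) s)"
    using ab inU m \<psi>
    by (intro integral_mono[OF int' int]) (auto simp: indicator_def)
  also have "\<dots> = avg_op I \<gamma> \<psi> t (indicat_real U) x"
    unfolding avg_op_def set_lebesgue_integral_def eq ..
  finally show ?thesis .
qed

end

section \<open>Cross products and triple products in three-space\<close>

unbundle cross3_syntax

text \<open>Cramer's rule: up to the triple product, the three cross products form the basis dual to
  a, b, c.\<close>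

lemma cross3_cramer:
  "(a \<bullet> (b \<times> c)) *\<^sub>R v = (v \<bullet> a) *\<^sub>R (b \<times> c) + (v \<bullet> b) *\<^sub>R (c \<times> a) + (v \<bullet> c) *\<^sub>R (a \<times> b)"
  by (simp add: cross3_simps forall_3)

lemma orthogonal_to_basis_imp_zero:
  fixes v :: "real^3"
  assumes "a \<bullet> (b \<times> c) \<noteq> 0" "v \<bullet> a = 0" "v \<bullet> b = 0" "v \<bullet> c = 0"
  shows "v = 0"
  using cross3_cramer[of a b c v] assms by simp

lemma bounded_bilinear_cross3: "bounded_bilinear (\<times>)"
  using bilinear_cross by (simp add: bilinear_conv_bounded_bilinear)

lemma has_vector_derivative_cross3:
  assumes "(f has_vector_derivative f') (at x)" "(g has_vector_derivative g') (at x)"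
  shows "((\<lambda>x. f x \<times> g x) has_vector_derivative (f x \<times> g' + f' \<times> g x)) (at x)"
  using bounded_bilinear.has_vector_derivative[OF bounded_bilinear_cross3 assms] .

lemma has_vector_derivative_inner:
  assumes "(f has_vector_derivative f') (at x)" "(g has_vector_derivative g') (at x)"
  shows "((\<lambda>x. f x \<bullet> g x) has_vector_derivative (f x \<bullet> g' + f' \<bullet> g x)) (at x)"
  using bounded_bilinear.has_vector_derivative[OF bounded_bilinear_inner assms] .

lemma has_vector_derivative_imp_zero_if_zero_on_open:
  assumes "(f has_vector_derivative f') (at x)" "open S" "x \<in> S" "\<And>y. y \<in> S \<Longrightarrow> f y = 0"
  shows "f' = 0"
proof -
  have "((\<lambda>x. 0) has_vector_derivative f') (at x)"
    using assms by (auto intro: has_vector_derivative_transform_within_open)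
  then show ?thesis by (metis has_vector_derivative_const vector_derivative_at)
qed

text \<open>Applied with \<open>v\<close> the error vector itself, this turns a scalar Taylor
  estimate into a norm estimate.\<close>

lemma norm_le_if_inner_le:
  fixes v :: "'a::real_inner"
  assumes "v \<bullet> v \<le> b * norm v" "b \<ge> 0"
  shows "norm v \<le> b"
proof (cases "v = 0")
  case False
  have "norm v * norm v \<le> b * norm v"
    using assms by (simp add: power2_norm_eq_inner flip: power2_eq_square)
  with False show ?thesis by simp
qed (use assms in simp)

section \<open>Transversality and Taylor estimates along the curve\<close>

context bump_curve
begin

abbreviation "D n \<equiv> iter_deriv I n \<gamma>"

lemma triple_product_nonzero: "s \<in> I \<Longrightarrow> D 1 s \<bullet> (D 2 s \<times> D 3 s) \<noteq> 0"
  using nondeg by (fastforce simp: nondegenerate_def dot_cross_det)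

lemma open_bump_support: "open {s. \<psi> s > 0}"
  using open_Collect_less[OF continuous_on_const continuous_bump, of 0] by simp

lemma bump_support_interior: "{s. \<psi> s > 0} \<subseteq> interior I"
  using bump closure_subset[of "{s. \<psi> s \<noteq> 0}"] by (force simp: bump_function_in_def)

text \<open>If \<open>det (\<gamma>, \<gamma>', \<gamma>'')\<close> vanished on an open set, differentiating it would make \<open>\<gamma>\<close> parallel
  to \<open>\<gamma>'\<close> there; differentiating \<open>\<gamma> \<times> \<gamma>' = 0\<close> then forces \<open>\<gamma> = 0\<close>.\<close>

lemma obtain_transversal_point:
  obtains s where "\<psi> s > 0" "D 0 s \<bullet> (D 1 s \<times> D 2 s) \<noteq> 0"
proof -
  let ?S = "{s. \<psi> s > 0}"
  obtain s0 where s0: "s0 \<in> ?S"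
    using bump by (auto simp: bump_function_in_def less_le)
  have False if zero: "\<And>s. s \<in> ?S \<Longrightarrow> D 0 s \<bullet> (D 1 s \<times> D 2 s) = 0"
  proof -
    have der: "(D n has_vector_derivative D (Suc n) s) (at s)" if "s \<in> ?S" for n s
      using that bump_support_interior by (intro has_vector_derivative_iter_deriv) auto
    have der': "(D 0 has_vector_derivative D 1 s) (at s)" "(D 1 has_vector_derivative D 2 s) (at s)"
      "(D 2 has_vector_derivative D 3 s) (at s)" if "s \<in> ?S" for s
      using der[OF that, of 0] der[OF that, of 1] der[OF that, of 2]
      by (simp_all add: numeral_2_eq_2 numeral_3_eq_3)
    have nz: "D 1 s \<bullet> (D 2 s \<times> D 3 s) \<noteq> 0" if "s \<in> ?S" for s
      using that bump_support_interior interior_subset[of I] by (intro triple_product_nonzero) auto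
    \<comment> \<open>In the derivative of the triple product, two of the three terms contain a
      repeated vector and vanish; the remaining one has \<open>D 3\<close> in place of
      \<open>D 2\<close>.\<close>
    have zero': "D 0 s \<bullet> (D 1 s \<times> D 3 s) = 0" if "s \<in> ?S" for s
    proof -
      note has_vector_derivative_inner[OF der'(1) has_vector_derivative_cross3[OF der'(2,3)], OF that that that]
      then have "D 0 s \<bullet> (D 1 s \<times> D 3 s + D 2 s \<times> D 2 s) + D 1 s \<bullet> (D 1 s \<times> D 2 s) = 0"
        by (rule has_vector_derivative_imp_zero_if_zero_on_open[OF _ open_bump_support that zero])
      then show ?thesis by (simp add: dot_cross_self)
    qed
    have par: "D 0 s \<times> D 1 s = 0" if "s \<in> ?S" for s
    proof (rule orthogonal_to_basis_imp_zero[OF nz[OF that]])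
      show "(D 0 s \<times> D 1 s) \<bullet> D 1 s = 0" by (simp add: dot_cross_self)
      show "(D 0 s \<times> D 1 s) \<bullet> D 2 s = 0" using zero[OF that] by (simp add: cross3_simps)
      show "(D 0 s \<times> D 1 s) \<bullet> D 3 s = 0" using zero'[OF that] by (simp add: cross3_simps)
    qed
    have par': "D 0 s \<times> D 2 s = 0" if "s \<in> ?S" for s
    proof -
      note has_vector_derivative_cross3[OF der'(1,2), OF that that]
      then have "D 0 s \<times> D 2 s + D 1 s \<times> D 1 s = 0"
        by (rule has_vector_derivative_imp_zero_if_zero_on_open[OF _ open_bump_support that par])
      then show ?thesis by simp
    qed
    have "D 0 s = 0" if "s \<in> ?S" for s
    proof -
      \<comment> \<open>The pairwise cross products of a basis again form a basis: their triple
        product is, up to sign, the square of the original one. The curve point is orthogonal to all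
        three of them.\<close>
      have *: "(D 1 s \<times> D 2 s) \<bullet> ((D 2 s \<times> D 3 s) \<times> (D 1 s \<times> D 3 s)) \<noteq> 0"
      proof -
        have "(D 1 s \<times> D 2 s) \<bullet> ((D 2 s \<times> D 3 s) \<times> (D 1 s \<times> D 3 s)) = - (D 1 s \<bullet> (D 2 s \<times> D 3 s))\<^sup>2"
          unfolding cross_cross_det by (simp add: dot_cross_self dot_cross_det[symmetric] inner_diff_right power2_eq_square) (simp add: cross3_simps)
        then show ?thesis using nz[OF that] by simp
      qed
      show ?thesis
      proof (rule orthogonal_to_basis_imp_zero[OF *])
        show "D 0 s \<bullet> (D 1 s \<times> D 2 s) = 0" by (rule zero[OF that])
        show "D 0 s \<bullet> (D 1 s \<times> D 3 s) = 0" by (rule zero'[OF that])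
        have "D 0 s \<bullet> (D 2 s \<times> D 3 s) = (D 0 s \<times> D 2 s) \<bullet> D 3 s" by (simp add: cross3_simps)
        then show "D 0 s \<bullet> (D 2 s \<times> D 3 s) = 0" using par'[OF that] by simp
      qed
    qed
    \<comment> \<open>A curve vanishing on an open set has zero velocity there, against
      non-degeneracy.\<close>
    then have "D 1 s0 = 0"
      by (intro has_vector_derivative_imp_zero_if_zero_on_open[OF der'(1)[OF s0] open_bump_support s0]) auto
    then show False using nz[OF s0] by simp
  qed
  then show ?thesis using that by blast
qed

text \<open>Lagrange's remainder exists for scalar functions only, so the curve is paired with a
  vector \<open>v\<close>, on which the intermediate point depends.\<close>

lemma taylor_inner:
  assumes "a < s" "{a..s} \<subseteq> interior I" "n > 0"
  obtains \<xi> where "\<xi> \<in> {a..s}"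
    "\<gamma> s \<bullet> v = (\<Sum>m<n. (D m a \<bullet> v) / fact m * (s - a) ^ m) + (D n \<xi> \<bullet> v) / fact n * (s - a) ^ n"
proof -
  have "\<forall>m t. m < n \<and> a \<le> t \<and> t \<le> s \<longrightarrow> DERIV (\<lambda>t. D m t \<bullet> v) t :> D (Suc m) t \<bullet> v"
  proof (intro strip)
    fix m t assume "m < n \<and> a \<le> t \<and> t \<le> s"
    then have "(D m has_vector_derivative D (Suc m) t) (at t)"
      using assms by (intro has_vector_derivative_iter_deriv) auto
    from bounded_linear.has_vector_derivative[OF bounded_linear_inner_left this, of v]
    show "DERIV (\<lambda>t. D m t \<bullet> v) t :> D (Suc m) t \<bullet> v"
      by (simp add: has_real_derivative_iff_has_vector_derivative)
  qed
  from Taylor_up[OF \<open>n > 0\<close> _ this order_refl \<open>a < s\<close>, of "\<lambda>t. \<gamma> t \<bullet> v"]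
  obtain \<xi> where "a < \<xi>" "\<xi> < s"
    "\<gamma> s \<bullet> v = (\<Sum>m<n. (D m a \<bullet> v) / fact m * (s - a) ^ m) + (D n \<xi> \<bullet> v) / fact n * (s - a) ^ n"
    by auto
  then show ?thesis by (intro that[of \<xi>]) auto
qed

lemma norm_diff_curve_le:
  assumes "a \<le> s" "{a..s} \<subseteq> interior I" "\<And>\<xi>. \<xi> \<in> {a..s} \<Longrightarrow> norm (D 1 \<xi>) \<le> K"
  shows "norm (\<gamma> s - \<gamma> a) \<le> K * (s - a)"
proof (cases "a = s")
  case False
  have K: "K \<ge> 0" using assms(1) order_trans[OF norm_ge_zero assms(3)[of a]] by simp
  let ?v = "\<gamma> s - \<gamma> a"
  obtain \<xi> where \<xi>: "\<xi> \<in> {a..s}" "\<gamma> s \<bullet> ?v = \<gamma> a \<bullet> ?v + (D 1 \<xi> \<bullet> ?v) * (s - a)"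
    by (rule taylor_inner[of a s 1 ?v]) (use assms False in auto)
  have "?v \<bullet> ?v = (D 1 \<xi> \<bullet> ?v) * (s - a)"
    using \<xi>(2) by (simp add: inner_diff_left)
  also have "\<dots> \<le> (K * norm ?v) * (s - a)"
    using assms \<xi> by (intro mult_right_mono order_trans[OF norm_cauchy_schwarz]) auto
  finally show ?thesis
    using assms K by (intro norm_le_if_inner_le) (auto simp: mult_ac)
qed simp

text \<open>If all velocities have a definite component along one fixed direction \<open>v\<close>,
  the chord has that component too, by the mean value theorem.\<close>

lemma norm_diff_curve_ge:
  assumes "a \<le> s" "{a..s} \<subseteq> interior I" "\<And>\<xi>. \<xi> \<in> {a..s} \<Longrightarrow> c * norm v \<le> D 1 \<xi> \<bullet> v" "v \<noteq> 0"
  shows "c * (s - a) \<le> norm (\<gamma> s - \<gamma> a)"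
proof (cases "a = s")
  case False
  obtain \<xi> where \<xi>: "\<xi> \<in> {a..s}" "\<gamma> s \<bullet> v = \<gamma> a \<bullet> v + (D 1 \<xi> \<bullet> v) * (s - a)"
    by (rule taylor_inner[of a s 1 v]) (use assms False in auto)
  have "(c * norm v) * (s - a) \<le> (D 1 \<xi> \<bullet> v) * (s - a)"
    using assms \<xi> by (intro mult_right_mono) auto
  also have "\<dots> = (\<gamma> s - \<gamma> a) \<bullet> v"
    using \<xi>(2) by (simp add: inner_diff_left)
  also have "\<dots> \<le> norm (\<gamma> s - \<gamma> a) * norm v"
    by (rule norm_cauchy_schwarz)
  finally show ?thesis
    using assms by (simp add: mult_ac)
qed simp

lemma norm_taylor_remainder_curve_le:
  assumes "a \<le> s" "{a..s} \<subseteq> interior I" "\<And>\<xi>. \<xi> \<in> {a..s} \<Longrightarrow> norm (D 3 \<xi>) \<le> K"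
  shows "norm (\<gamma> s - \<gamma> a - (s - a) *\<^sub>R D 1 a - ((s - a)\<^sup>2 / 2) *\<^sub>R D 2 a) \<le> K * (s - a) ^ 3"
proof (cases "a = s")
  case False
  have K: "K \<ge> 0" using assms(1) order_trans[OF norm_ge_zero assms(3)[of a]] by simp
  let ?v = "\<gamma> s - \<gamma> a - (s - a) *\<^sub>R D 1 a - ((s - a)\<^sup>2 / 2) *\<^sub>R D 2 a"
  obtain \<xi> where \<xi>: "\<xi> \<in> {a..s}"
    "\<gamma> s \<bullet> ?v = \<gamma> a \<bullet> ?v + (D 1 a \<bullet> ?v) * (s - a) + (D 2 a \<bullet> ?v) / 2 * (s - a)\<^sup>2 + (D 3 \<xi> \<bullet> ?v) / 6 * (s - a) ^ 3"
  proof (rule taylor_inner[of a s 3 ?v])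
    fix \<xi> assume \<xi>: "\<xi> \<in> {a..s}"
      and eq: "\<gamma> s \<bullet> ?v = (\<Sum>m<3. (D m a \<bullet> ?v) / fact m * (s - a) ^ m) + (D 3 \<xi> \<bullet> ?v) / fact 3 * (s - a) ^ 3"
    have sum3: "(\<Sum>m<3. f m) = f 0 + f 1 + f 2" for f :: "nat \<Rightarrow> real"
      by (simp add: eval_nat_numeral)
    have fact: "fact 0 = (1::real)" "fact 1 = (1::real)" "fact 2 = (2::real)" "fact 3 = (6::real)"
      by (simp_all add: eval_nat_numeral)
    show thesis
      using eq unfolding sum3 fact by (intro that[OF \<xi>]) simp
  qed (use assms False in auto)
  have "?v \<bullet> ?v = \<gamma> s \<bullet> ?v - \<gamma> a \<bullet> ?v - (s - a) * (D 1 a \<bullet> ?v) - ((s - a)\<^sup>2 / 2) * (D 2 a \<bullet> ?v)"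
    by (simp only: inner_diff_left inner_scaleR_left)
  also have "\<dots> = (D 3 \<xi> \<bullet> ?v) / 6 * (s - a) ^ 3"
    unfolding \<xi>(2) by (simp del: One_nat_def)
  also have "\<dots> \<le> (K * norm ?v) * (s - a) ^ 3"
  proof (intro mult_right_mono)
    have "D 3 \<xi> \<bullet> ?v \<le> K * norm ?v"
      using assms(3)[OF \<xi>(1)] by (intro order_trans[OF norm_cauchy_schwarz] mult_right_mono) auto
    moreover have "0 \<le> K * norm ?v" using K by simp
    ultimately show "(D 3 \<xi> \<bullet> ?v) / 6 \<le> K * norm ?v" by linarith
  qed (use assms in simp)
  finally show ?thesis
    using assms K by (intro norm_le_if_inner_le) (auto simp: mult_ac)
qed (use assms(3)[of a] in simp)

lemma bounded_iter_deriv: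
  assumes "{a..b} \<subseteq> I"
  shows "\<exists>K>0. \<forall>s\<in>{a..b}. norm (D n s) \<le> K"
proof -
  have "bounded (D n ` {a..b})"
    using assms continuous_on_iter_deriv[of n] continuous_on_subset
    by (intro compact_imp_bounded compact_continuous_image) auto
  then show ?thesis by (simp add: bounded_pos)
qed

end

section \<open>A short arc with uniform constants\<close>

locale transversal_arc = bump_curve +
  fixes a \<eta> m c g K :: real
  assumes pos: "\<eta> > 0" "m > 0" "c > 0" "g > 0" "K > 0"
    and arc_subset: "{a..a+\<eta>} \<subseteq> I"
    and transversal: "\<gamma> a \<bullet> (D 1 a \<times> D 2 a) \<noteq> 0"
    and bump_ge: "s \<in> {a..a+\<eta>} \<Longrightarrow> m \<le> \<psi> s"
    and norm_ge: "s \<in> {a..a+\<eta>} \<Longrightarrow> g \<le> norm (\<gamma> s)"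
    and arc_separated: "r \<in> {a..a+\<eta>} \<Longrightarrow> s \<in> {a..a+\<eta>} \<Longrightarrow> c * \<bar>r - s\<bar> \<le> norm (\<gamma> r - \<gamma> s)"
    and arc_lipschitz: "r \<in> {a..a+\<eta>} \<Longrightarrow> s \<in> {a..a+\<eta>} \<Longrightarrow> norm (\<gamma> r - \<gamma> s) \<le> K * \<bar>r - s\<bar>"
    and taylor_remainder: "s \<in> {a..a+\<eta>} \<Longrightarrow>
      norm (\<gamma> s - \<gamma> a - (s - a) *\<^sub>R D 1 a - ((s - a)\<^sup>2 / 2) *\<^sub>R D 2 a) \<le> K * (s - a) ^ 3"

text \<open>The needed strict inequalities hold at a transversal point \<open>a\<close> of the
  support, hence by continuity nearby. Bounds on the first and third derivatives come from
  compactness of the arc.\<close>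

lemma (in bump_curve) obtain_transversal_arc:
  obtains a \<eta> m c g K where "transversal_arc I \<gamma> \<psi> a \<eta> m c g K"
proof -
  obtain a where a: "\<psi> a > 0" "\<gamma> a \<bullet> (D 1 a \<times> D 2 a) \<noteq> 0"
    using obtain_transversal_point by auto
  have aI: "a \<in> interior I" using a bump_support_interior by auto
  define T where "T = D 1 a"
  have T: "T \<noteq> 0" and G: "\<gamma> a \<noteq> 0" using a by (auto simp: T_def)
  have cont: "(D n \<longlongrightarrow> D n a) (nhds a)" for n
    using has_vector_derivative_iter_deriv[OF aI, of n] 
    by (auto dest: has_vector_derivative_continuous simp: continuous_within tendsto_nhds_iff)
  have "isCont \<psi> a"
    using continuous_bump by (simp add: continuous_on_eq_continuous_at)
  then have "(\<psi> \<longlongrightarrow> \<psi> a) (nhds a)"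
    by (simp add: isCont_def tendsto_nhds_iff)
  then have "\<forall>\<^sub>F s in nhds a. \<psi> a / 2 < \<psi> s"
    using a by (intro order_tendstoD) auto
  moreover have "\<forall>\<^sub>F s in nhds a. norm (\<gamma> a) / 2 < norm (\<gamma> s)"
    using tendsto_norm[OF cont[of 0]] G by (intro order_tendstoD) auto
  \<comment> \<open>Velocities stay close to the direction \<open>T\<close>; this is what makes the
    arc separated with constant \<open>norm T / 2\<close>.\<close>
  moreover have "\<forall>\<^sub>F s in nhds a. (T \<bullet> T) / 2 < D 1 s \<bullet> T"
    using tendsto_inner[OF cont[of 1] tendsto_const[of T]] T
    unfolding T_def by (intro order_tendstoD) auto
  moreover have "\<forall>\<^sub>F s in nhds a. s \<in> interior I"
    using aI by (intro eventually_nhds_in_open) auto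
  ultimately have "\<forall>\<^sub>F s in nhds a. \<psi> a / 2 < \<psi> s \<and> norm (\<gamma> a) / 2 < norm (\<gamma> s) \<and>
      (T \<bullet> T) / 2 < D 1 s \<bullet> T \<and> s \<in> interior I"
    by eventually_elim auto
  then obtain d where d: "d > 0" "\<And>s. dist s a < d \<Longrightarrow> \<psi> a / 2 < \<psi> s \<and> norm (\<gamma> a) / 2 < norm (\<gamma> s) \<and>
      (T \<bullet> T) / 2 < D 1 s \<bullet> T \<and> s \<in> interior I"
    unfolding eventually_nhds_metric by auto
  \<comment> \<open>Half the radius, so that the closed arc lies in the open ball.\<close>
  define \<eta> where "\<eta> = d / 2"
  have arc: "\<psi> a / 2 < \<psi> s" "norm (\<gamma> a) / 2 < norm (\<gamma> s)" "(T \<bullet> T) / 2 < D 1 s \<bullet> T" "s \<in> interior I"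
    if "s \<in> {a..a+\<eta>}" for s
    using d(2)[of s] that \<open>d > 0\<close> by (auto simp: \<eta>_def dist_real_def)
  have sub: "{a..a+\<eta>} \<subseteq> interior I" and subI: "{a..a+\<eta>} \<subseteq> I" using arc(4) interior_subset[of I] by auto
  obtain K1 where K1: "K1 > 0" "\<And>s. s \<in> {a..a+\<eta>} \<Longrightarrow> norm (D 1 s) \<le> K1"
    using bounded_iter_deriv[OF subI, of 1] by blast
  obtain K3 where K3: "K3 > 0" "\<And>s. s \<in> {a..a+\<eta>} \<Longrightarrow> norm (D 3 s) \<le> K3"
    using bounded_iter_deriv[OF subI, of 3] by blast
  have lower: "norm T / 2 * (s - r) \<le> norm (\<gamma> s - \<gamma> r)" if "r \<in> {a..a+\<eta>}" "s \<in> {a..a+\<eta>}" "r \<le> s" for r s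
  proof (rule norm_diff_curve_ge[of r s _ T])
    show "norm T / 2 * norm T \<le> D 1 \<xi> \<bullet> T" if "\<xi> \<in> {r..s}" for \<xi>
      using arc(3)[of \<xi>] that \<open>r \<in> _\<close> \<open>s \<in> _\<close> by (auto simp: power2_norm_eq_inner simp flip: power2_eq_square)
  qed (use that sub T in auto)
  \<comment> \<open>The sum \<open>K1 + K3\<close> is used so that one constant serves both as
    Lipschitz constant and in the Taylor remainder.\<close>
  have upper: "norm (\<gamma> s - \<gamma> r) \<le> (K1 + K3) * (s - r)" if "r \<in> {a..a+\<eta>}" "s \<in> {a..a+\<eta>}" "r \<le> s" for r s
  proof (rule norm_diff_curve_le)
    show "norm (D 1 \<xi>) \<le> K1 + K3" if "\<xi> \<in> {r..s}" for \<xi>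
      using K1(2)[of \<xi>] K3(1) that \<open>r \<in> _\<close> \<open>s \<in> _\<close> by auto
  qed (use that sub in auto)
  show ?thesis
  proof (rule that[of a \<eta> "\<psi> a / 2" "norm T / 2" "norm (\<gamma> a) / 2" "K1 + K3"], unfold_locales)
    show "norm T / 2 * \<bar>r - s\<bar> \<le> norm (\<gamma> r - \<gamma> s)" if "r \<in> {a..a+\<eta>}" "s \<in> {a..a+\<eta>}" for r s
      using lower[OF that] lower[OF that(2,1)] by (cases "r \<le> s") (auto simp: norm_minus_commute)
    show "norm (\<gamma> r - \<gamma> s) \<le> (K1 + K3) * \<bar>r - s\<bar>" if "r \<in> {a..a+\<eta>}" "s \<in> {a..a+\<eta>}" for r s
      using upper[OF that] upper[OF that(2,1)] by (cases "r \<le> s") (auto simp: norm_minus_commute)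
    show "norm (\<gamma> s - \<gamma> a - (s - a) *\<^sub>R D 1 a - ((s - a)\<^sup>2 / 2) *\<^sub>R D 2 a) \<le> (K1 + K3) * (s - a) ^ 3"
      if "s \<in> {a..a+\<eta>}" for s
    proof (rule norm_taylor_remainder_curve_le)
      show "norm (D 3 \<xi>) \<le> K1 + K3" if "\<xi> \<in> {a..s}" for \<xi>
        using K3(2)[of \<xi>] K1(1) that \<open>s \<in> _\<close> by auto
    qed (use that sub in auto)
  qed (use d K1 K3 T G a arc(1,2) subI in \<open>auto simp: \<eta>_def less_imp_le\<close>)
qed

section \<open>Bounds for a single average\<close>

lemma interval_near_subdivision_point:
  fixes s :: real
  assumes "s \<in> {a..a+\<eta>}" "\<eta> > 0" "n > 0"
  obtains j where "j \<le> n" "\<bar>s - (a + \<eta> * real j / real n)\<bar> \<le> \<eta> / real n"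
proof -
  define q where "q = (s - a) * real n / \<eta>"
  define j where "j = nat \<lfloor>q\<rfloor>"
  have q: "0 \<le> q" "q \<le> real n"
    using assms mult_right_mono[of "s - a" \<eta> "real n"] by (auto simp: q_def pos_divide_le_eq mult_ac)
  have j: "real j \<le> q" "q < real j + 1" using q by (auto simp: j_def)
  have s: "s - (a + \<eta> * real j / real n) = (q - real j) * (\<eta> / real n)"
    using assms by (simp add: q_def field_simps)
  have "\<bar>(q - real j) * (\<eta> / real n)\<bar> \<le> 1 * (\<eta> / real n)"
    unfolding abs_mult using assms j by (intro mult_mono) auto
  moreover have "j \<le> n" using j q by linarith
  ultimately show ?thesis using s by (intro that[of j]) auto
qed

context transversal_arc
begin

lemma strong_type_avg_op_imp_ge:
  assumes t: "t > 0" and p: "p > 0"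
    and T: "strong_type p \<alpha> C (\<lambda>f x. ennreal \<bar>avg_op I \<gamma> \<psi> t f x\<bar>)"
  shows "- 1 \<le> \<alpha>"
proof (rule ccontr)
  assume "\<not> - 1 \<le> \<alpha>"
  then have \<alpha>: "\<alpha> < 0" "\<alpha> < -1" by auto
  \<comment> \<open>In units of 1/n, the term 1 bounds the norm of a point of \<open>E\<close>, and
    the rest bounds the distance from a point of the dilated arc to a nearby subdivision
    point.\<close>
  define R where "R = 1 + t * K * \<eta>"
  define \<kappa> where "\<kappa> = unit_ball_vol 3"
  have \<kappa>: "\<kappa> > 0" by (simp add: \<kappa>_def)
  have R: "R \<ge> 1" using t pos by (simp add: R_def)
  define C' where "C' = max C 0"
  \<comment> \<open>The second threshold on n makes the radius of the covering balls at most
    \<open>t * g / 2\<close>, half the distance of the dilated arc from the origin.\<close>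
  have "\<forall>\<^sub>F n in sequentially.
      ((m * \<eta>) powr p * (\<kappa> / 64)) * (1 / real n) powr (\<alpha> + 3)
      \<le> (C' * (t * g / 2) powr \<alpha> * (2 * \<kappa> * R ^ 3)) * (1 / real n) powr 2"
    using eventually_gt_at_top[of 0] eventually_ge_at_top[of "nat \<lceil>2 * R / (t * g)\<rceil>"]
  proof eventually_elim
    case (elim n)
    define \<delta> where "\<delta> = 1 / real n"
    have \<delta>: "\<delta> > 0" using elim by (simp add: \<delta>_def)
    have "2 * R / (t * g) \<le> real n" using elim by linarith
    then have Rn: "R * \<delta> \<le> t * g / 2" using t pos elim by (simp add: \<delta>_def field_simps)
    define s where "s j = a + \<eta> * real j / real n" for j
    have s: "s j \<in> {a..a+\<eta>}" if "j \<le> n" for j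
      using that pos elim by (auto simp: s_def field_simps)
    define U where "U = (\<Union>j\<in>{..n}. cball (- t *\<^sub>R \<gamma> (s j)) (R * \<delta>))"
    \<comment> \<open>\<open>E\<close> must avoid the origin, where \<open>0 powr \<alpha> = 0\<close> even for \<open>\<alpha> < 0\<close>.\<close>
    define v where "v = (\<delta> / 2) *\<^sub>R (axis 1 1 :: real^3)"
    define E where "E = cball v (\<delta> / 4)"
    have nv: "norm v = \<delta> / 2" using \<delta> by (simp add: v_def norm_axis_1)
    have E: "\<delta> / 4 \<le> norm x" "norm x \<le> \<delta>" if "x \<in> E" for x
    proof -
      have "norm (v - x) \<le> \<delta> / 4" using that by (simp add: E_def dist_norm)
      then show "\<delta> / 4 \<le> norm x" "norm x \<le> \<delta>"
        using nv norm_triangle_ineq2[of v x] norm_triangle_ineq2[of x v] \<delta> by (auto simp: norm_minus_commute)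
    qed
    have Ucompact: "compact U" unfolding U_def by (intro compact_UN) auto
    have nU: "t * g / 2 \<le> norm y" if "y \<in> U" for y
    proof -
      obtain j where j: "j \<le> n" "norm (- t *\<^sub>R \<gamma> (s j) - y) \<le> R * \<delta>"
        using \<open>y \<in> U\<close> by (auto simp: U_def dist_norm)
      have "t * g \<le> norm (- t *\<^sub>R \<gamma> (s j))" using norm_ge[OF s[OF j(1)]] t by simp
      then show ?thesis using norm_triangle_ineq2[of "- t *\<^sub>R \<gamma> (s j)" y] j(2) Rn by linarith
    qed
    have avg: "m * \<eta> \<le> avg_op I \<gamma> \<psi> t (indicat_real U) x" if x: "x \<in> E" for x
    proof -
      have "m * (a + \<eta> - a) \<le> avg_op I \<gamma> \<psi> t (indicat_real U) x"
      proof (rule avg_op_indicator_ge)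
        fix r assume r: "r \<in> {a..a+\<eta>}"
        obtain j where j: "j \<le> n" "\<bar>r - s j\<bar> \<le> \<eta> / real n"
          unfolding s_def using interval_near_subdivision_point r pos(1) elim(1) by blast
        have "norm (\<gamma> r - \<gamma> (s j)) \<le> K * \<bar>r - s j\<bar>"
          by (rule arc_lipschitz[OF r s[OF j(1)]])
        also have "\<dots> \<le> K * (\<eta> * \<delta>)"
          using j(2) pos by (intro mult_left_mono) (auto simp: \<delta>_def)
        finally have "t * norm (\<gamma> r - \<gamma> (s j)) \<le> t * (K * (\<eta> * \<delta>))" using t by simp
        moreover have "norm (- t *\<^sub>R \<gamma> (s j) - (x - t *\<^sub>R \<gamma> r)) \<le> norm x + t * norm (\<gamma> r - \<gamma> (s j))"
        proof -
          have "- t *\<^sub>R \<gamma> (s j) - (x - t *\<^sub>R \<gamma> r) = t *\<^sub>R (\<gamma> r - \<gamma> (s j)) - x" by (simp add: algebra_simps)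
          also have "norm \<dots> \<le> norm (t *\<^sub>R (\<gamma> r - \<gamma> (s j))) + norm x"
            by (rule norm_triangle_ineq4)
          finally show ?thesis using t by simp
        qed
        moreover have "R * \<delta> = \<delta> + t * (K * (\<eta> * \<delta>))" by (simp add: R_def algebra_simps)
        ultimately have "norm (- t *\<^sub>R \<gamma> (s j) - (x - t *\<^sub>R \<gamma> r)) \<le> R * \<delta>"
          using E(2)[OF x] by linarith
        then show "x - t *\<^sub>R \<gamma> r \<in> U" using j(1) by (auto simp: U_def dist_norm)
      qed (use pos arc_subset bump_ge Ucompact compact_imp_closed in auto)
      then show ?thesis by simp
    qed
    \<comment> \<open>For negative \<alpha> the weight decreases in the norm: the upper bound
      \<delta> for the norm on \<open>E\<close> and the lower bound on \<open>U\<close> are the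
      relevant ones.\<close>
    have "(m * \<eta>) powr p * \<delta> powr \<alpha> * measure lebesgue E \<le> C' * (t * g / 2) powr \<alpha> * measure lebesgue U"
      unfolding C'_def
    proof (rule strong_type_indicator[OF T p])
      show "norm y powr \<alpha> \<le> (t * g / 2) powr \<alpha>" if "y \<in> U" for y
        using nU[OF that] t pos \<alpha> by (intro powr_mono2') auto
      show "\<delta> powr \<alpha> \<le> norm x powr \<alpha>" if "x \<in> E" for x
        using E[OF that] \<delta> \<alpha> by (intro powr_mono2') auto
      show "ennreal (m * \<eta>) \<le> ennreal \<bar>avg_op I \<gamma> \<psi> t (indicat_real U) x\<bar>" if "x \<in> E" for x
        using avg[OF that] by (intro ennreal_leI) auto
    qed (use Ucompact lmeasurable_compact pos in \<open>auto simp: E_def\<close>)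
    also have "measure lebesgue E = \<kappa> / 64 * \<delta> ^ 3"
      using \<delta> by (simp add: E_def \<kappa>_def content_cball power_divide)
    also have "(m * \<eta>) powr p * \<delta> powr \<alpha> * (\<kappa> / 64 * \<delta> ^ 3) = ((m * \<eta>) powr p * (\<kappa> / 64)) * \<delta> powr (\<alpha> + 3)"
      using \<delta> by (simp add: powr_add)
    also have "C' * (t * g / 2) powr \<alpha> * measure lebesgue U
        \<le> C' * (t * g / 2) powr \<alpha> * (2 * \<kappa> * R ^ 3 * \<delta> powr 2)"
    proof (intro mult_left_mono)
      have "measure lebesgue U \<le> (\<Sum>j\<in>{..n}. measure lebesgue (cball (- t *\<^sub>R \<gamma> (s j)) (R * \<delta>)))"
        unfolding U_def by (intro measure_UNION_le) auto
      also have "\<dots> = (real n + 1) * (\<kappa> * (R * \<delta>) ^ 3)"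
        using R \<delta> by (simp add: \<kappa>_def content_cball)
      also have "\<dots> \<le> (2 * real n) * (\<kappa> * (R * \<delta>) ^ 3)"
        using R \<delta> \<kappa> elim(1) by (intro mult_right_mono) auto
      also have "\<dots> = 2 * \<kappa> * R ^ 3 * \<delta> powr 2"
        using elim(1) by (simp add: \<delta>_def field_simps power2_eq_square power3_eq_cube powr_divide)
      finally show "measure lebesgue U \<le> 2 * \<kappa> * R ^ 3 * \<delta> powr 2" .
    qed (simp add: C'_def)
    finally show ?case by (simp add: \<delta>_def mult_ac)
  qed
  then have "2 \<le> \<alpha> + 3"
    by (rule exponent_le_if_eventually_le) (use pos \<kappa> in simp)
  with \<alpha> show False by simp
qed

lemma strong_type_avg_op_imp_le:
  assumes t: "t > 0" and p: "p > 1"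
    and T: "strong_type p \<alpha> C (\<lambda>f x. ennreal \<bar>avg_op I \<gamma> \<psi> t f x\<bar>)"
  shows "\<alpha> \<le> p - 1"
proof (rule ccontr)
  assume "\<not> \<alpha> \<le> p - 1"
  then have \<alpha>: "\<alpha> > 0" "\<alpha> > p - 1" using p by auto
  \<comment> \<open>Neighbouring subdivision points of the dilated arc are at least
    \<open>t * c * \<eta>\<close> / n apart. A third of this as radius keeps the balls
    \<open>B j\<close> disjoint, so their volumes add up.\<close>
  define \<rho> where "\<rho> = t * c * \<eta> / 3"
  \<comment> \<open>A ball of radius \<open>R\<close> / n about the origin contains
    \<open>x - t *\<^sub>R \<gamma> r\<close> for x in \<open>B j\<close> and r in the j-th subarc,
    whose length \<eta>/n yields the factor \<delta> in the average.\<close>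
  define R where "R = \<rho> + t * K * \<eta>"
  define \<kappa> where "\<kappa> = unit_ball_vol 3"
  have \<kappa>: "\<kappa> > 0" by (simp add: \<kappa>_def)
  have \<rho>: "\<rho> > 0" using t pos by (simp add: \<rho>_def)
  have R: "R > 0" using \<rho> t pos by (simp add: R_def add_pos_pos)
  define C' where "C' = max C 0"
  have "\<forall>\<^sub>F n in sequentially.
      ((m * \<eta>) powr p * (t * g / 2) powr \<alpha> * (\<kappa> * \<rho> ^ 3)) * (1 / real n) powr (p + 2)
      \<le> (C' * R powr \<alpha> * (\<kappa> * R ^ 3)) * (1 / real n) powr (\<alpha> + 3)"
    using eventually_gt_at_top[of 0] eventually_ge_at_top[of "nat \<lceil>2 * \<rho> / (t * g)\<rceil>"]
  proof eventually_elim
    case (elim n)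
    define \<delta> where "\<delta> = 1 / real n"
    have \<delta>: "\<delta> > 0" using elim by (simp add: \<delta>_def)
    have "2 * \<rho> / (t * g) \<le> real n" using elim by linarith
    then have \<rho>n: "\<rho> * \<delta> \<le> t * g / 2" using t pos elim by (simp add: \<delta>_def field_simps)
    define s where "s j = a + \<eta> * real j * \<delta>" for j
    \<comment> \<open>Left endpoints only, j < n, so that the whole j-th subarc stays inside the
      arc.\<close>
    have s: "s j \<in> {a..a+\<eta>}" "s j + \<eta> * \<delta> \<le> a + \<eta>" if "j < n" for j
    proof -
      have "(real j + 1) * \<delta> \<le> 1" using that by (simp add: \<delta>_def field_simps)
      then have "\<eta> * ((real j + 1) * \<delta>) \<le> \<eta> * 1" using pos by (intro mult_left_mono) auto
      then show "s j + \<eta> * \<delta> \<le> a + \<eta>" by (simp add: s_def algebra_simps)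
      moreover have "0 \<le> \<eta> * real j * \<delta>" "0 \<le> \<eta> * \<delta>" using pos \<delta> by auto
      ultimately show "s j \<in> {a..a+\<eta>}" unfolding s_def atLeastAtMost_iff by linarith
    qed
    define B where "B j = cball (t *\<^sub>R \<gamma> (s j)) (\<rho> * \<delta>)" for j
    define E where "E = (\<Union>j\<in>{..<n}. B j)"
    have disj: "disjoint_family_on B {..<n}"
      unfolding disjoint_family_on_def
    proof (intro ballI impI)
      fix i j assume ij: "i \<in> {..<n}" "j \<in> {..<n}" "i \<noteq> j"
      have "1 \<le> \<bar>real i - real j\<bar>" using ij(3) by linarith
      then have "\<eta> * \<delta> * 1 \<le> \<eta> * \<delta> * \<bar>real i - real j\<bar>" using pos \<delta> by (intro mult_left_mono) auto
      also have "\<dots> = \<bar>\<eta> * \<delta> * (real i - real j)\<bar>" using pos \<delta> by (simp add: abs_mult)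
      also have "\<dots> = \<bar>s i - s j\<bar>" by (simp add: s_def algebra_simps)
      finally have "t * (c * (\<eta> * \<delta>)) \<le> t * (c * \<bar>s i - s j\<bar>)" using t pos by simp
      also have "\<dots> \<le> t * norm (\<gamma> (s i) - \<gamma> (s j))" using arc_separated s ij t by simp
      also have "\<dots> = dist (t *\<^sub>R \<gamma> (s i)) (t *\<^sub>R \<gamma> (s j))"
        using t by (simp add: dist_norm flip: scaleR_diff_right)
      finally have far: "3 * (\<rho> * \<delta>) \<le> dist (t *\<^sub>R \<gamma> (s i)) (t *\<^sub>R \<gamma> (s j))" by (simp add: \<rho>_def mult_ac)
      show "B i \<inter> B j = {}"
      proof (rule ccontr)
        assume "B i \<inter> B j \<noteq> {}"
        then obtain x where x: "dist (t *\<^sub>R \<gamma> (s i)) x \<le> \<rho> * \<delta>" "dist (t *\<^sub>R \<gamma> (s j)) x \<le> \<rho> * \<delta>"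
          by (auto simp: B_def)
        moreover have "\<rho> * \<delta> > 0" using \<rho> \<delta> by simp
        ultimately show False using far dist_triangle2[of "t *\<^sub>R \<gamma> (s i)" "t *\<^sub>R \<gamma> (s j)" x] by linarith
      qed
    qed
    have avg: "m * (\<eta> * \<delta>) \<le> avg_op I \<gamma> \<psi> t (indicat_real (cball 0 (R * \<delta>))) x" if "x \<in> E" for x
    proof -
      obtain j where j: "j < n" "norm (t *\<^sub>R \<gamma> (s j) - x) \<le> \<rho> * \<delta>"
        using \<open>x \<in> E\<close> by (auto simp: E_def B_def dist_norm)
      have sub_arc: "{s j..s j + \<eta> * \<delta>} \<subseteq> {a..a+\<eta>}" using s[OF j(1)] by auto
      have "m * (s j + \<eta> * \<delta> - s j) \<le> avg_op I \<gamma> \<psi> t (indicat_real (cball 0 (R * \<delta>))) x"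
      proof (rule avg_op_indicator_ge)
        fix r assume r: "r \<in> {s j..s j + \<eta> * \<delta>}"
        have "norm (\<gamma> (s j) - \<gamma> r) \<le> K * \<bar>s j - r\<bar>" using arc_lipschitz s j r sub_arc by blast
        also have "\<dots> \<le> K * (\<eta> * \<delta>)" using r pos by (intro mult_left_mono) auto
        finally have "t * norm (\<gamma> (s j) - \<gamma> r) \<le> t * (K * (\<eta> * \<delta>))" using t by simp
        moreover have "norm (x - t *\<^sub>R \<gamma> r) \<le> norm (t *\<^sub>R \<gamma> (s j) - x) + t * norm (\<gamma> (s j) - \<gamma> r)"
        proof -
          have "x - t *\<^sub>R \<gamma> r = t *\<^sub>R (\<gamma> (s j) - \<gamma> r) - (t *\<^sub>R \<gamma> (s j) - x)" by (simp add: algebra_simps)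
          also have "norm \<dots> \<le> norm (t *\<^sub>R (\<gamma> (s j) - \<gamma> r)) + norm (t *\<^sub>R \<gamma> (s j) - x)"
            by (rule norm_triangle_ineq4)
          finally show ?thesis using t by simp
        qed
        moreover have "R * \<delta> = \<rho> * \<delta> + t * (K * (\<eta> * \<delta>))" by (simp add: R_def algebra_simps)
        ultimately show "x - t *\<^sub>R \<gamma> r \<in> cball 0 (R * \<delta>)" using j(2) by simp
      qed (use pos \<delta> arc_subset sub_arc bump_ge in auto)
      then show ?thesis by simp
    qed
    have "(m * (\<eta> * \<delta>)) powr p * (t * g / 2) powr \<alpha> * measure lebesgue E
        \<le> C' * (R * \<delta>) powr \<alpha> * measure lebesgue (cball (0::real^3) (R * \<delta>))"
      unfolding C'_def
    proof (rule strong_type_indicator[OF T])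
      show "E \<in> lmeasurable"
        unfolding E_def B_def by (intro lmeasurable_compact compact_UN) auto
      show "norm y powr \<alpha> \<le> (R * \<delta>) powr \<alpha>" if "y \<in> cball 0 (R * \<delta>)" for y :: "real^3"
        using that \<alpha> by (intro powr_mono2) auto
      show "(t * g / 2) powr \<alpha> \<le> norm x powr \<alpha>" if x: "x \<in> E" for x
      proof (rule powr_mono2)
        obtain j where j: "j < n" "norm (t *\<^sub>R \<gamma> (s j) - x) \<le> \<rho> * \<delta>"
          using x by (auto simp: E_def B_def dist_norm)
        have "t * g \<le> norm (t *\<^sub>R \<gamma> (s j))" using norm_ge[OF s(1)[OF j(1)]] t by simp
        then show "t * g / 2 \<le> norm x"
          using norm_triangle_ineq2[of "t *\<^sub>R \<gamma> (s j)" x] j(2) \<rho>n by linarith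
      qed (use \<alpha> t pos in auto)
      show "ennreal (m * (\<eta> * \<delta>)) \<le> ennreal \<bar>avg_op I \<gamma> \<psi> t (indicat_real (cball 0 (R * \<delta>))) x\<bar>" if "x \<in> E" for x
        using avg[OF that] by (intro ennreal_leI) auto
    qed (use pos \<delta> p in auto)
    also have "measure lebesgue E = (\<Sum>j<n. measure lebesgue (B j))"
      unfolding E_def using disj by (intro measure_UNION') (auto simp: B_def disjoint_family_on_def pairwise_def disjnt_def)
    also have "\<dots> = real n * (\<kappa> * (\<rho> * \<delta>) ^ 3)"
      using \<rho> \<delta> by (simp add: B_def \<kappa>_def content_cball)
    also have "\<dots> = \<kappa> * \<rho> ^ 3 * \<delta> powr 2"
      using elim(1) by (simp add: \<delta>_def field_simps power2_eq_square power3_eq_cube powr_divide)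
    also have "measure lebesgue (cball (0::real^3) (R * \<delta>)) = \<kappa> * R ^ 3 * \<delta> powr 3"
      using R \<delta> by (simp add: \<kappa>_def content_cball power_mult_distrib)
    finally have "(m * \<eta>) powr p * \<delta> powr p * (t * g / 2) powr \<alpha> * (\<kappa> * \<rho> ^ 3 * \<delta> powr 2)
        \<le> C' * (R powr \<alpha> * \<delta> powr \<alpha>) * (\<kappa> * R ^ 3 * \<delta> powr 3)"
      using pos \<delta> R by (simp add: powr_mult mult_ac)
    then show ?case unfolding \<delta>_def[symmetric] powr_add by (simp only: mult_ac)
  qed
  then have "\<alpha> + 3 \<le> p + 2"
    by (rule exponent_le_if_eventually_le) (use t pos \<kappa> \<rho> in simp)
  with \<alpha> show False by simp
qed

end

section \<open>Bounds for the local maximal operator\<close>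

lemma content_cbox_vector_3:
  fixes a b c x y z :: real
  assumes "a \<le> x" "b \<le> y" "c \<le> z"
  shows "measure lborel (cbox (vector [a, b, c]) (vector [x, y, z] :: real^3)) = (x - a) * (y - b) * (z - c)"
proof -
  have "vector [a, b, c] \<in> cbox (vector [a, b, c]) (vector [x, y, z] :: real^3)"
    using assms unfolding mem_box_cart forall_3 by simp
  then have ne: "cbox (vector [a, b, c]) (vector [x, y, z] :: real^3) \<noteq> {}"
    by blast
  have prod_3: "prod f (UNIV :: 3 set) = f 1 * f 2 * f 3" for f :: "3 \<Rightarrow> real"
    unfolding UNIV_3 by (simp add: mult.assoc)
  show ?thesis
    unfolding content_cbox_cart[OF ne] prod_3 by simp
qed

lemma mem_cbox_vector_3:
  "v \<in> cbox (vector [a, b, c]) (vector [x, y, z] :: real^3) \<longleftrightarrow>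
     v $ 1 \<in> {a..x} \<and> v $ 2 \<in> {b..y} \<and> v $ 3 \<in> {c..z}"
  unfolding mem_box_cart forall_3 by auto

section \<open>Boxes in coordinates adapted to the dilations\<close>

context transversal_arc
begin

text \<open>The third axis is the direction of \<gamma>(a), so moving by a multiple of \<gamma>(a)
  changes only the third coordinate.\<close>

definition frame :: "real^3 \<Rightarrow> real^3" where
  "frame y = (y $ 1) *\<^sub>R D 1 a + (y $ 2) *\<^sub>R D 2 a + (y $ 3) *\<^sub>R \<gamma> a"

lemma linear_frame: "linear frame"
  by (rule linearI) (simp_all add: frame_def algebra_simps)

lemma inj_frame: "inj frame"
  unfolding linear_injective_0[OF linear_frame]
proof (intro allI impI)
  fix y assume "frame y = 0"
  then have *: "frame y \<bullet> v = 0" for v by simp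
  \<comment> \<open>Pairing with the cross product of two frame vectors isolates the coordinate of
    the third.\<close>
  have "y $ 3 * (\<gamma> a \<bullet> (D 1 a \<times> D 2 a)) = 0"
    using *[of "D 1 a \<times> D 2 a"] by (simp add: frame_def inner_add_left dot_cross_self)
  moreover have "y $ 1 * (\<gamma> a \<bullet> (D 1 a \<times> D 2 a)) = 0"
    using *[of "D 2 a \<times> \<gamma> a"] by (simp add: frame_def inner_add_left dot_cross_self) (simp add: cross3_simps)
  moreover have "y $ 2 * (\<gamma> a \<bullet> (D 1 a \<times> D 2 a)) = 0"
    using *[of "\<gamma> a \<times> D 1 a"] by (simp add: frame_def inner_add_left dot_cross_self) (simp add: cross3_simps)
  ultimately show "y = 0"
    using transversal by (simp add: vec_eq_iff forall_3)
qed

lemma frame_bounded_below: "\<exists>b>0. \<forall>y. b * norm y \<le> norm (frame y)"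
  by (rule linear_inj_bounded_below_pos[OF linear_frame inj_frame]) blast

definition frame_box :: "real \<Rightarrow> real \<Rightarrow> real \<Rightarrow> real \<Rightarrow> (real^3) set" where
  "frame_box k u v w = frame ` {y. \<bar>y $ 1\<bar> \<le> u \<and> \<bar>y $ 2\<bar> \<le> v \<and> \<bar>y $ 3 - k\<bar> \<le> w}"

lemma frame_box_eq: "frame_box k u v w = frame ` cbox (vector [-u, -v, k - w]) (vector [u, v, k + w])"
proof -
  have "{y :: real^3. \<bar>y $ 1\<bar> \<le> u \<and> \<bar>y $ 2\<bar> \<le> v \<and> \<bar>y $ 3 - k\<bar> \<le> w} = cbox (vector [-u, -v, k - w]) (vector [u, v, k + w])"
    by (auto simp: set_eq_iff mem_cbox_vector_3 abs_le_iff)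
  then show ?thesis by (simp add: frame_box_def)
qed

lemma compact_frame_box: "compact (frame_box k u v w)"
  unfolding frame_box_eq
  by (rule compact_continuous_image[OF linear_continuous_on compact_cbox])
     (use linear_frame in \<open>simp only: linear_conv_bounded_linear\<close>)

lemma measure_frame_box:
  assumes "u \<ge> 0" "v \<ge> 0" "w \<ge> 0"
  shows "measure lebesgue (frame_box k u v w) = \<bar>det (matrix frame)\<bar> * (8 * u * v * w)"
  unfolding frame_box_eq measure_linear_image[OF linear_frame lmeasurable_cbox]
  using assms by (simp add: content_cbox_vector_3)

text \<open>With h = s - a, the point \<gamma>(s) has frame coordinates (h, h^2/2, 1) up to an error
  of order \<delta>^3. The dilation \<open>u $ 3 - k\<close> is chosen to bring the third coordinate
  back to k up to this error. In \<open>R\<close>, the 3 covers u and the main terms for dilations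
  up to 2, and \<open>2 * K / b\<close> covers the error, \<open>b\<close> converting norms into
  coordinate bounds.\<close>

lemma translate_in_frame_box:
  assumes b: "b > 0" "\<And>y. b * norm y \<le> norm (frame y)"
    and \<delta>: "0 < \<delta>" "\<delta> \<le> 1" "\<delta> \<le> \<eta>"
    and R: "R = 3 + 2 * K / b"
    and u: "\<bar>u $ 1\<bar> \<le> \<delta>" "\<bar>u $ 2\<bar> \<le> \<delta>\<^sup>2" "0 \<le> u $ 3 - k" "u $ 3 - k \<le> 2"
    and s: "s \<in> {a..a+\<delta>}"
  shows "frame u - (u $ 3 - k) *\<^sub>R \<gamma> s \<in> frame_box k (R * \<delta>) (R * \<delta>\<^sup>2) (R * \<delta> ^ 3)"
proof -
  define t where "t = u $ 3 - k"
  define h where "h = s - a"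
  have h: "0 \<le> h" "h \<le> \<delta>" using s by (auto simp: h_def)
  have t: "0 \<le> t" "t \<le> 2" using u by (auto simp: t_def)
  define rem where "rem = \<gamma> s - \<gamma> a - h *\<^sub>R D 1 a - (h\<^sup>2 / 2) *\<^sub>R D 2 a"
  obtain w where w: "rem = frame w"
    using linear_injective_imp_surjective[OF linear_frame inj_frame] by (metis surjD)
  have "b * norm w \<le> K * h ^ 3"
    using b(2)[of w] taylor_remainder[of s] s \<delta> unfolding w[symmetric] rem_def h_def by force
  also have "\<dots> \<le> K * \<delta> ^ 3" using pos h by (intro mult_left_mono power_mono) auto
  finally have nw: "norm w \<le> K / b * \<delta> ^ 3" using b by (simp add: field_simps)
  have wi: "\<bar>t * w $ i\<bar> \<le> 2 * K / b * \<delta> ^ 3" for i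
  proof -
    have "\<bar>t * w $ i\<bar> \<le> 2 * norm w"
      unfolding abs_mult using t component_le_norm_cart[of w i] by (intro mult_mono) auto
    with nw show ?thesis by simp
  qed
  have th: "\<bar>t * h\<bar> \<le> 2 * \<delta>" "\<bar>t * (h\<^sup>2 / 2)\<bar> \<le> \<delta>\<^sup>2"
  proof -
    show "\<bar>t * h\<bar> \<le> 2 * \<delta>" unfolding abs_mult using t h by (intro mult_mono) auto
    have "\<bar>t * (h\<^sup>2 / 2)\<bar> \<le> 2 * (\<delta>\<^sup>2 / 2)"
      unfolding abs_mult using t h by (intro mult_mono) (auto intro: power_mono)
    then show "\<bar>t * (h\<^sup>2 / 2)\<bar> \<le> \<delta>\<^sup>2" by simp
  qed
  have Kb: "0 \<le> 2 * K / b" using pos b by simp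
  \<comment> \<open>As \<delta> is at most 1, the cubic error also fits into the two longer
    sides.\<close>
  have \<delta>3: "\<delta> ^ 3 \<le> \<delta>" "\<delta> ^ 3 \<le> \<delta>\<^sup>2"
    using \<delta> power_decreasing[of 1 3 \<delta>] power_decreasing[of 2 3 \<delta>] by auto
  have K\<delta>: "2 * K / b * \<delta> ^ 3 \<le> 2 * K / b * \<delta>" "2 * K / b * \<delta> ^ 3 \<le> 2 * K / b * \<delta>\<^sup>2"
    by (rule mult_left_mono[OF \<delta>3(1) Kb], rule mult_left_mono[OF \<delta>3(2) Kb])
  have R': "R * \<delta> = 3 * \<delta> + 2 * K / b * \<delta>" "R * \<delta>\<^sup>2 = 3 * \<delta>\<^sup>2 + 2 * K / b * \<delta>\<^sup>2"
    "R * \<delta> ^ 3 = 3 * \<delta> ^ 3 + 2 * K / b * \<delta> ^ 3"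
    by (simp_all add: R algebra_simps)
  define v :: "real^3" where "v = vector [u $ 1 - t * h - t * w $ 1, u $ 2 - t * (h\<^sup>2 / 2) - t * w $ 2, k - t * w $ 3]"
  have "\<gamma> s = \<gamma> a + h *\<^sub>R D 1 a + (h\<^sup>2 / 2) *\<^sub>R D 2 a + frame w"
    using w by (simp add: rem_def algebra_simps)
  then have "frame u - t *\<^sub>R \<gamma> s = frame v"
    by (simp add: frame_def v_def t_def algebra_simps)
  moreover have "\<bar>v $ 1\<bar> \<le> R * \<delta>" "\<bar>v $ 2\<bar> \<le> R * \<delta>\<^sup>2" "\<bar>v $ 3 - k\<bar> \<le> R * \<delta> ^ 3"
  proof -
    have "0 \<le> \<delta>\<^sup>2" "0 \<le> \<delta> ^ 3" using \<delta> by auto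
    then have "\<bar>u $ 1 - t * h - t * w $ 1\<bar> \<le> R * \<delta>" "\<bar>u $ 2 - t * (h\<^sup>2 / 2) - t * w $ 2\<bar> \<le> R * \<delta>\<^sup>2"
      "\<bar>t * w $ 3\<bar> \<le> R * \<delta> ^ 3"
      using wi[of 1] wi[of 2] wi[of 3] u(1,2) th K\<delta> R' by linarith+
    then show "\<bar>v $ 1\<bar> \<le> R * \<delta>" "\<bar>v $ 2\<bar> \<le> R * \<delta>\<^sup>2" "\<bar>v $ 3 - k\<bar> \<le> R * \<delta> ^ 3"
      by (simp_all add: v_def)
  qed
  ultimately show ?thesis by (auto simp: frame_box_def t_def)
qed

text \<open>The long box is centred at height k + 3/2 with half-height 1/2, so the dilation carrying
  a point back to the small box lies in [1,2]. The subarc of length \<delta> gives an average of at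
  least \<open>m * \<delta>\<close>.\<close>

lemma frame_box_test:
  assumes T: "strong_type p \<alpha> C (max_op_loc I \<gamma> \<psi>)" and p: "p > 0"
    and b: "b > 0" "\<And>y. b * norm y \<le> norm (frame y)"
    and \<delta>: "0 < \<delta>" "\<delta> \<le> 1" "\<delta> \<le> \<eta>"
    and R: "R = 3 + 2 * K / b"
    and W: "W \<ge> 0" "\<And>x. x \<in> frame_box k (R * \<delta>) (R * \<delta>\<^sup>2) (R * \<delta> ^ 3) \<Longrightarrow> norm x powr \<alpha> \<le> W"
    and w: "w \<ge> 0" "\<And>x. x \<in> frame_box (k + 3 / 2) \<delta> (\<delta>\<^sup>2) (1 / 2) \<Longrightarrow> w \<le> norm x powr \<alpha>"
  shows "(m powr p * w * 4) * \<delta> powr (p + 3) \<le> max C 0 * W * (8 * R ^ 3) * \<delta> powr 6"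
proof -
  let ?U = "frame_box k (R * \<delta>) (R * \<delta>\<^sup>2) (R * \<delta> ^ 3)"
  let ?E = "frame_box (k + 3 / 2) \<delta> (\<delta>\<^sup>2) (1 / 2)"
  let ?d = "\<bar>det (matrix frame)\<bar>"
  have Rpos: "R > 0" using R b pos by (simp add: add_pos_nonneg)
  have d: "?d > 0" using inj_frame det_nz_iff_inj[OF linear_frame] by simp
  have U: "compact ?U" "?U \<in> lmeasurable" and E: "?E \<in> lmeasurable"
    by (simp_all add: compact_frame_box lmeasurable_compact)
  have max_ge: "ennreal (m * \<delta>) \<le> max_op_loc I \<gamma> \<psi> (indicat_real ?U) x" if "x \<in> ?E" for x
  proof -
    obtain u where u: "x = frame u" "\<bar>u $ 1\<bar> \<le> \<delta>" "\<bar>u $ 2\<bar> \<le> \<delta>\<^sup>2" "\<bar>u $ 3 - (k + 3 / 2)\<bar> \<le> 1 / 2"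
      using \<open>x \<in> ?E\<close> by (auto simp: frame_box_def)
    have t: "1 \<le> u $ 3 - k" "u $ 3 - k \<le> 2" using u(4) unfolding abs_le_iff by linarith+
    have "m * (a + \<delta> - a) \<le> avg_op I \<gamma> \<psi> (u $ 3 - k) (indicat_real ?U) x"
    proof (rule avg_op_indicator_ge)
      show "x - (u $ 3 - k) *\<^sub>R \<gamma> s \<in> ?U" if "s \<in> {a..a+\<delta>}" for s
        unfolding u(1) using u t that by (intro translate_in_frame_box[OF b \<delta> R]) auto
    qed (use U pos \<delta> arc_subset bump_ge compact_imp_closed in auto)
    then have "ennreal (m * \<delta>) \<le> ennreal \<bar>avg_op I \<gamma> \<psi> (u $ 3 - k) (indicat_real ?U) x\<bar>"
      by (intro ennreal_leI) auto
    also have "\<dots> \<le> max_op_loc I \<gamma> \<psi> (indicat_real ?U) x"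
      using t by (rule avg_op_le_max_op_loc)
    finally show ?thesis .
  qed
  have "(m * \<delta>) powr p * w * measure lebesgue ?E \<le> max C 0 * W * measure lebesgue ?U"
    using pos \<delta> by (intro strong_type_indicator[OF T p U(2) E W w _ max_ge]) auto
  also have "measure lebesgue ?E = ?d * (4 * \<delta> ^ 3)"
    using \<delta> by (simp add: measure_frame_box power2_eq_square power3_eq_cube)
  also have "measure lebesgue ?U = ?d * (8 * R ^ 3 * \<delta> ^ 6)"
    using \<delta> Rpos by (simp add: measure_frame_box eval_nat_numeral)
  \<comment> \<open>Both volumes carry the Jacobian of the frame, which cancels.\<close>
  finally have "?d * ((m powr p * w * 4) * (\<delta> powr p * \<delta> ^ 3)) \<le> ?d * (max C 0 * W * (8 * R ^ 3) * \<delta> ^ 6)"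
    using pos \<delta> by (simp add: powr_mult mult_ac)
  with d have "(m powr p * w * 4) * (\<delta> powr p * \<delta> ^ 3) \<le> max C 0 * W * (8 * R ^ 3) * \<delta> ^ 6"
    by (simp only: mult_le_cancel_left_pos)
  then show ?thesis using \<delta> by (simp add: powr_add)
qed

lemma strong_type_max_op_loc_imp_le:
  assumes T: "strong_type p \<alpha> C (max_op_loc I \<gamma> \<psi>)" and p: "p > 0"
  shows "\<alpha> \<le> p - 3"
proof -
  obtain b where b: "b > 0" "\<And>y. b * norm y \<le> norm (frame y)"
    using frame_bounded_below by blast
  obtain B where B: "B > 0" "\<And>y. norm (frame y) \<le> B * norm y"
    using linear_bounded_pos[OF linear_frame] by auto
  define R where "R = 3 + 2 * K / b"
  have R: "R > 0" using b pos by (simp add: R_def add_pos_nonneg)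
  have small: "\<forall>\<^sub>F n::nat in sequentially. 0 < 1 / real n \<and> 1 / real n \<le> e" if "e > 0" for e :: real
    using eventually_gt_at_top[of 0] eventually_ge_at_top[of "nat \<lceil>1 / e\<rceil>"]
  proof eventually_elim
    case (elim n)
    then have "1 / e \<le> real n" by linarith
    with elim that show ?case by (simp add: field_simps)
  qed
  have frame_box_bounds: "\<exists>y. frame y = x \<and> \<bar>y $ 1\<bar> \<le> u \<and> \<bar>y $ 2\<bar> \<le> v \<and> \<bar>y $ 3 - k\<bar> \<le> w \<and> b * \<bar>y $ 3\<bar> \<le> norm x
      \<and> norm x \<le> B * (u + v + \<bar>k\<bar> + w)"
    if "x \<in> frame_box k u v w" for x k u v w
  proof -
    obtain y :: "real^3" where y: "x = frame y" "\<bar>y $ 1\<bar> \<le> u" "\<bar>y $ 2\<bar> \<le> v" "\<bar>y $ 3 - k\<bar> \<le> w"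
      using \<open>x \<in> _\<close> by (auto simp: frame_box_def)
    have "norm y \<le> \<bar>y $ 1\<bar> + \<bar>y $ 2\<bar> + \<bar>y $ 3\<bar>"
      using norm_le_l1_cart[of y] by (simp add: sum_3)
    also have "\<dots> \<le> u + v + \<bar>k\<bar> + w" using y by linarith
    finally have "B * norm y \<le> B * (u + v + \<bar>k\<bar> + w)" using B by simp
    moreover have "b * \<bar>y $ 3\<bar> \<le> b * norm y" using b component_le_norm_cart[of y 3] by simp
    ultimately show ?thesis using y b(2)[of y] B(2)[of y] by force
  qed
  show ?thesis
  proof (cases "\<alpha> \<ge> 0")
    case True
    \<comment> \<open>The small box is placed at the origin, where the weight contributes a factor
      \<delta>^\<alpha>; on the long box the third coordinate is at least 1.\<close>
    have e: "min 1 \<eta> > 0" using pos by simp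
    have "\<forall>\<^sub>F n in sequentially.
        (m powr p * b powr \<alpha> * 4) * (1 / real n) powr (p + 3)
        \<le> (max C 0 * (B * (3 * R)) powr \<alpha> * (8 * R ^ 3)) * (1 / real n) powr (\<alpha> + 6)"
      using small[OF e]
    proof eventually_elim
      case (elim n)
      define \<delta> where "\<delta> = 1 / real n"
      have \<delta>: "0 < \<delta>" "\<delta> \<le> 1" "\<delta> \<le> \<eta>" using elim by (auto simp: \<delta>_def)
      have "(m powr p * b powr \<alpha> * 4) * \<delta> powr (p + 3)
          \<le> max C 0 * (B * (3 * R * \<delta>)) powr \<alpha> * (8 * R ^ 3) * \<delta> powr 6"
      proof (rule frame_box_test[OF T p b \<delta> R_def, of _ 0])
        fix x assume "x \<in> frame_box 0 (R * \<delta>) (R * \<delta>\<^sup>2) (R * \<delta> ^ 3)"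
        then have "norm x \<le> B * (R * \<delta> + R * \<delta>\<^sup>2 + R * \<delta> ^ 3)" using frame_box_bounds by fastforce
        also have "\<dots> \<le> B * (3 * R * \<delta>)"
        proof (intro mult_left_mono)
          have "R * \<delta>\<^sup>2 \<le> R * \<delta>" "R * \<delta> ^ 3 \<le> R * \<delta>"
            using \<delta> R power_decreasing[of 1 2 \<delta>] power_decreasing[of 1 3 \<delta>] by auto
          then show "R * \<delta> + R * \<delta>\<^sup>2 + R * \<delta> ^ 3 \<le> 3 * R * \<delta>" by linarith
        qed (use B in simp)
        finally show "norm x powr \<alpha> \<le> (B * (3 * R * \<delta>)) powr \<alpha>" using True by (intro powr_mono2) auto
      next
        fix x assume "x \<in> frame_box (0 + 3 / 2) \<delta> (\<delta>\<^sup>2) (1 / 2)"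
        from frame_box_bounds[OF this] obtain y :: "real^3" where y: "\<bar>y $ 3 - 3 / 2\<bar> \<le> 1 / 2" "b * \<bar>y $ 3\<bar> \<le> norm x" by auto
        have "b * 1 \<le> b * \<bar>y $ 3\<bar>" using y(1) b by (intro mult_left_mono) linarith+
        with y(2) have "b \<le> norm x" by simp
        then show "b powr \<alpha> \<le> norm x powr \<alpha>" using True b by (intro powr_mono2) auto
      qed auto
      also have "(B * (3 * R * \<delta>)) powr \<alpha> = (B * (3 * R)) powr \<alpha> * \<delta> powr \<alpha>"
        using B R \<delta> by (simp add: powr_mult)
      finally show ?case unfolding \<delta>_def[symmetric] powr_add by (simp only: mult_ac)
    qed
    then have "\<alpha> + 6 \<le> p + 3"
      by (rule exponent_le_if_eventually_le) (use pos b in simp)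
    then show ?thesis by simp
  next
    case False
    \<comment> \<open>The bound \<open>1 / (2 * R)\<close> keeps the third coordinate at least 1/2
      on the box about \<gamma>(a). The weight then only affects constants, and p >= 3 suffices
      because \<alpha> < 0.\<close>
    have e: "min (min 1 \<eta>) (1 / (2 * R)) > 0" using pos R by simp
    have "\<forall>\<^sub>F n in sequentially.
        (m powr p * (B * 5) powr \<alpha> * 4) * (1 / real n) powr (p + 3)
        \<le> (max C 0 * (b / 2) powr \<alpha> * (8 * R ^ 3)) * (1 / real n) powr 6"
      using small[OF e]
    proof eventually_elim
      case (elim n)
      define \<delta> where "\<delta> = 1 / real n"
      have \<delta>: "0 < \<delta>" "\<delta> \<le> 1" "\<delta> \<le> \<eta>" and \<delta>R: "R * \<delta> \<le> 1 / 2"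
        using elim R by (auto simp: \<delta>_def field_simps)
      have "(m powr p * (B * 5) powr \<alpha> * 4) * \<delta> powr (p + 3)
          \<le> max C 0 * (b / 2) powr \<alpha> * (8 * R ^ 3) * \<delta> powr 6"
      proof (rule frame_box_test[OF T p b \<delta> R_def, of _ 1])
        fix x assume "x \<in> frame_box 1 (R * \<delta>) (R * \<delta>\<^sup>2) (R * \<delta> ^ 3)"
        from frame_box_bounds[OF this] obtain y :: "real^3" where y: "\<bar>y $ 3 - 1\<bar> \<le> R * \<delta> ^ 3" "b * \<bar>y $ 3\<bar> \<le> norm x" by auto
        have "R * \<delta> ^ 3 \<le> R * \<delta>" using \<delta> R power_decreasing[of 1 3 \<delta>] by auto
        with y(1) \<delta>R have "1 / 2 \<le> \<bar>y $ 3\<bar>" by linarith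
        then have "b * (1 / 2) \<le> b * \<bar>y $ 3\<bar>" using b by (intro mult_left_mono) auto
        with y(2) have "b / 2 \<le> norm x" by simp
        then show "norm x powr \<alpha> \<le> (b / 2) powr \<alpha>" using False b by (intro powr_mono2') auto
      next
        fix x assume "x \<in> frame_box (1 + 3 / 2) \<delta> (\<delta>\<^sup>2) (1 / 2)"
        from frame_box_bounds[OF this] obtain y :: "real^3" where y: "\<bar>y $ 3 - (1 + 3 / 2)\<bar> \<le> 1 / 2" "b * \<bar>y $ 3\<bar> \<le> norm x"
          "norm x \<le> B * (\<delta> + \<delta>\<^sup>2 + \<bar>1 + 3 / 2\<bar> + 1 / 2)" by blast
        have "\<delta>\<^sup>2 \<le> 1" using \<delta> by (simp add: power_le_one)
        \<comment> \<open>The 5 is 1 + 1 + 5/2 + 1/2.\<close>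
        then have "B * (\<delta> + \<delta>\<^sup>2 + \<bar>1 + 3 / 2\<bar> + 1 / 2) \<le> B * 5" using B \<delta> by (intro mult_left_mono) auto
        with y(3) have "norm x \<le> B * 5" by linarith
        \<comment> \<open>Strict positivity is essential for a negative exponent, since
          \<open>0 powr \<alpha>\<close> is 0.\<close>
        moreover have "0 < b * \<bar>y $ 3\<bar>" using y(1) b by (intro mult_pos_pos) linarith+
        ultimately show "(B * 5) powr \<alpha> \<le> norm x powr \<alpha>" using False y(2) by (intro powr_mono2') auto
      qed auto
      then show ?case by (simp add: \<delta>_def)
    qed
    then have "6 \<le> p + 3"
      by (rule exponent_le_if_eventually_le) (use pos B in simp)
    with False show ?thesis by simp
  qed
qed

end

section \<open>Necessary conditions for averages and maximal operators\<close>

theorem theorem1p1: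
  fixes I :: "real set" and \<gamma> :: "real \<Rightarrow> real^3" and \<psi> :: "real \<Rightarrow> real" and p \<alpha> :: real
  assumes "is_interval I"
    and "smooth_within I \<gamma>"
    and "nondegenerate I \<gamma>"
    and "bump_function_in I \<psi>"
    and "1 < p"
  shows
    "(\<forall>t>0.
        (\<exists>C::real. \<forall>f\<in>weighted_Lp p \<alpha>.
           weighted_integral p \<alpha> (\<lambda>x. ennreal \<bar>avg_op I \<gamma> \<psi> t f x\<bar>)
             \<le> ennreal C * weighted_integral p \<alpha> (\<lambda>x. ennreal \<bar>f x\<bar>))
        \<longrightarrow> - 1 \<le> \<alpha> \<and> \<alpha> \<le> p - 1) \<and>
     (bounded_on_weighted_Lp p \<alpha> (max_op I \<gamma> \<psi>) \<longrightarrow> - 1 \<le> \<alpha> \<and> \<alpha> \<le> p - 3) \<and>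
     (bounded_on_weighted_Lp p \<alpha> (max_op_loc I \<gamma> \<psi>) \<longrightarrow> - 1 \<le> \<alpha> \<and> \<alpha> \<le> p - 3)"
proof -
  interpret bump_curve I \<gamma> \<psi> using assms by unfold_locales
  obtain a \<eta> m c g K where "transversal_arc I \<gamma> \<psi> a \<eta> m c g K"
    by (rule obtain_transversal_arc)
  then interpret transversal_arc I \<gamma> \<psi> a \<eta> m c g K .
  have loc: "- 1 \<le> \<alpha> \<and> \<alpha> \<le> p - 3" if T: "strong_type p \<alpha> C (max_op_loc I \<gamma> \<psi>)" for C
  proof
    \<comment> \<open>The lower bound on \<alpha> already follows from the single average at t = 1,
      which the local maximal function dominates.\<close>
    have "strong_type p \<alpha> C (\<lambda>f x. ennreal \<bar>avg_op I \<gamma> \<psi> 1 f x\<bar>)"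
      using assms by (intro strong_type_mono[OF T] avg_op_le_max_op_loc) auto
    then show "- 1 \<le> \<alpha>"
      using assms by (intro strong_type_avg_op_imp_ge[of 1 p]) auto
    show "\<alpha> \<le> p - 3"
      using assms by (intro strong_type_max_op_loc_imp_le[OF T]) auto
  qed
  show ?thesis
  proof (intro conjI[of "\<forall>t>0. _ t"] conjI[of "_ \<longrightarrow> _"] allI impI)
    fix t :: real
    assume t: "t > 0" and "\<exists>C::real. \<forall>f\<in>weighted_Lp p \<alpha>.
           weighted_integral p \<alpha> (\<lambda>x. ennreal \<bar>avg_op I \<gamma> \<psi> t f x\<bar>)
             \<le> ennreal C * weighted_integral p \<alpha> (\<lambda>x. ennreal \<bar>f x\<bar>)"
    then obtain C where T: "strong_type p \<alpha> C (\<lambda>f x. ennreal \<bar>avg_op I \<gamma> \<psi> t f x\<bar>)"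
      by (auto simp: strong_type_def)
    show "- 1 \<le> \<alpha> \<and> \<alpha> \<le> p - 1"
      using strong_type_avg_op_imp_ge[OF t _ T] strong_type_avg_op_imp_le[OF t _ T] assms by simp
  next
    assume "bounded_on_weighted_Lp p \<alpha> (max_op I \<gamma> \<psi>)"
    then obtain C where "strong_type p \<alpha> C (max_op I \<gamma> \<psi>)"
      by (rule strong_type_if_bounded) (use assms in simp)
    then show "- 1 \<le> \<alpha> \<and> \<alpha> \<le> p - 3"
      using assms by (intro loc strong_type_mono[OF _ _ max_op_loc_le_max_op]) auto
  next
    assume "bounded_on_weighted_Lp p \<alpha> (max_op_loc I \<gamma> \<psi>)"
    then obtain C where "strong_type p \<alpha> C (max_op_loc I \<gamma> \<psi>)"
      by (rule strong_type_if_bounded) (use assms in simp)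
    then show "- 1 \<le> \<alpha> \<and> \<alpha> \<le> p - 3"
      by (rule loc)
  qed
qed

end
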